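(* There exists an absolute constant $C$ such that, for every set $\mathcal{P}_0$ of prime numbers and every positive integer $N$ with $\pi_0(N)\ge1$ and $\log\log N\ge2$, $$\|S_N\|_{\mathcal{H}^\infty(\mathcal{P}_0)}\le C\,\pi_0(N)\log\log N.$$
   Context: For a set $\mathcal{P}_0$ of primes, $\pi_0(x):=\#\{p\in\mathcal{P}_0:p\le x\}$, and $\mathcal{N}_0$ is the set of $\mathcal{P}_0$-smooth integers, i.e. positive integers all of whose prime divisors lie in $\mathcal{P}_0$. $\mathcal{H}^\infty$ is the space of bounded analytic functions on $\{\operatorname{Re}s>0\}$ that can be represented by a Dirichlet series $\sum_{n\ge1}a_nn^{-s}$ convergent in some half-plane, with the supremum norm over $\operatorname{Re}s>0$. $\mathcal{H}^\infty(\mathcal{P}_0)$ is the subspace of those $f\in\mathcal{H}^\infty$ with $a_n=0$ for $n\notin\mathcal{N}_0$. The partial sum operator is $(S_Nf)(s):=\sum_{n\le N}a_nn^{-s}$ for $f(s)=\sum_{n\ge1}a_nn^{-s}$, and $\|S_N\|_{\mathcal{H}^\infty(\mathcal{P}_0)}$ is the norm of $S_N$ as an operator restricted to $\mathcal{H}^\infty(\mathcal{P}_0)$. *)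

theory Defs
  imports "HOL-Analysis.Analysis" "HOL-Computational_Algebra.Primes"
begin

definition right_half_plane :: "complex set" where
  "right_half_plane = {s. Re s > 0}"

text \<open>
  Functions on the right half-plane are modelled as total functions of type
  \<^typ>\<open>complex \<Rightarrow> complex\<close>; their values outside it never matter, which is why the
  half-plane of convergence below is taken inside it. Coefficient sequences are indexed by
  \<open>n \<ge> 1\<close>, and the value at \<open>0\<close> is never used.
\<close>

definition has_dirichlet_series :: "(complex \<Rightarrow> complex) \<Rightarrow> (nat \<Rightarrow> complex) \<Rightarrow> bool" where
  "has_dirichlet_series f a \<longleftrightarrow>
     (\<exists>\<sigma>\<ge>0. \<forall>s. Re s > \<sigma> \<longrightarrow> (\<lambda>n. a (Suc n) * of_nat (Suc n) powr (- s)) sums f s)"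

text \<open>
  By uniqueness of Dirichlet coefficients, the values at \<open>n \<ge> 1\<close> do not depend on the choice.
\<close>

definition dirichlet_coeff :: "(complex \<Rightarrow> complex) \<Rightarrow> nat \<Rightarrow> complex" where
  "dirichlet_coeff f = (SOME a. has_dirichlet_series f a)"

definition H_infinity :: "(complex \<Rightarrow> complex) set" where
  "H_infinity = {f. f analytic_on right_half_plane \<and> bounded (f ` right_half_plane) \<and>
                    (\<exists>a. has_dirichlet_series f a)}"

definition smooth_integers :: "nat set \<Rightarrow> nat set" where
  "smooth_integers P0 = {n. n > 0 \<and> (\<forall>p. prime p \<and> p dvd n \<longrightarrow> p \<in> P0)}"

definition H_infinity_on :: "nat set \<Rightarrow> (complex \<Rightarrow> complex) set" where
  "H_infinity_on P0 =
     {f \<in> H_infinity. \<forall>n\<ge>1. n \<notin> smooth_integers P0 \<longrightarrow> dirichlet_coeff f n = 0}"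

definition prime_count :: "nat set \<Rightarrow> real \<Rightarrow> nat" where
  "prime_count P0 x = card {p \<in> P0. real p \<le> x}"

definition partial_sum_op :: "nat \<Rightarrow> (complex \<Rightarrow> complex) \<Rightarrow> complex \<Rightarrow> complex" where
  "partial_sum_op N f = (\<lambda>s. \<Sum>n=1..N. dirichlet_coeff f n * of_nat n powr (- s))"

text \<open>
  Both norms take values in \<^typ>\<open>ereal\<close>, so that an upper bound on them really asserts
  boundedness, which a supremum in \<^typ>\<open>real\<close> would not.
\<close>

definition sup_norm :: "(complex \<Rightarrow> complex) \<Rightarrow> ereal" where
  "sup_norm f = (SUP s\<in>right_half_plane. ereal (norm (f s)))"

definition operator_norm_on ::
    "(complex \<Rightarrow> complex) set \<Rightarrow> ((complex \<Rightarrow> complex) \<Rightarrow> complex \<Rightarrow> complex) \<Rightarrow> ereal" where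
  "operator_norm_on V T = (SUP f\<in>{f \<in> V. sup_norm f \<le> 1}. sup_norm (T f))"

end

theory Submission
  imports Defs "HOL-Analysis.Kronecker_Approximation_Theorem"
    "HOL-Probability.Probability" "HOL-Complex_Analysis.Complex_Analysis"
begin

text \<open>
  Suppose that natural numbers \<open>Q p\<close> and \<open>q\<close> are such that, for \<open>P0\<close>-smooth \<open>n = \<Prod>p ^ v\<^sub>p\<close>, one has
  \<open>n \<le> N\<close> if and only if \<open>\<Sum>v\<^sub>p * Q p \<le> q\<close>. By Kronecker's theorem a Dirichlet polynomial remains
  bounded by the same constant when every \<open>p powr (- s)\<close> is replaced by \<open>w ^ Q p\<close> with \<open>\<bar>w\<bar> = 1\<close>, so its
  partial sum at \<open>N\<close> is the partial sum at \<open>q\<close> of a bounded polynomial in one variable, and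
  Landau's inequality bounds it by \<open>1 + ln (q + 1)\<close>. General elements of the Hardy space reduce to Dirichlet
  polynomials by Gaussian smoothing in the vertical direction.

  It remains to find weights with \<open>ln q\<close> of order \<open>k * ln (ln N)\<close>, where \<open>k\<close> is the number of primes
  available. The values \<open>ln p\<close> are real weights with the required property, which is expressed by finitely many
  linear inequalities in \<open>k + 2\<close> unknowns with integer coefficients of size \<open>O(ln N)\<close>. Such a system has
  a solution in integers of size \<open>O(k * ln N) ^ (k + 1)\<close>. When \<open>k > ln N\<close>, rounding large multiples
  of \<open>ln p\<close> does better.
\<close>

section \<open>Landau's inequality\<close>

text \<open>These are the Taylor coefficients of \<open>(1 - w) powr (-1/2)\<close>, that is,
  \<open>(2 * j choose j) / 4 ^ j\<close>.\<close>

definition landau_coeff :: "nat \<Rightarrow> real" where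
  "landau_coeff j = (-1) ^ j * ((-1/2) gchoose j)"

text \<open>The square of \<open>(1 - w) powr (-1/2)\<close> is the geometric series. On
  coefficients this is Vandermonde's identity with both upper entries equal to
  \<open>-1/2\<close>.\<close>

lemma landau_coeff_convolution: "(\<Sum>j\<le>n. landau_coeff j * landau_coeff (n - j)) = 1"
proof -
  have "(\<Sum>j\<le>n. landau_coeff j * landau_coeff (n - j))
      = (\<Sum>j\<in>{0..n}. (-1) ^ n * (((-1/2) gchoose j) * ((-1/2) gchoose (n - j))))"
    unfolding landau_coeff_def atMost_atLeast0
  proof (rule sum.cong[OF refl])
    fix j assume "j \<in> {0..n}"
    then have signs: "(-1::real) ^ j * (-1) ^ (n - j) = (-1) ^ n"
      by (simp flip: power_add)
    have regroup: "x * u * (y * v) = (x * y) * (u * v)" for x u y v :: real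
      by simp
    show "(- 1) ^ j * (- 1 / 2 gchoose j) * ((- 1) ^ (n - j) * (- 1 / 2 gchoose (n - j))) =
        (- 1) ^ n * ((- 1 / 2 gchoose j) * (- 1 / 2 gchoose (n - j)) :: real)"
      by (simp only: regroup signs)
  qed
  also have "\<dots> = (-1) ^ n * ((-1) gchoose n)"
    by (simp add: sum_distrib_left[symmetric] gbinomial_Vandermonde)
  also have "\<dots> = 1"
    using gbinomial_minus[of "1::real" n] binomial_gbinomial[of n n, where 'a=real]
    by (simp flip: power_mult_distrib)
  finally show ?thesis .
qed

lemma landau_coeff_sq_le: "(landau_coeff j)\<^sup>2 \<le> 1 / (real j + 1)"
proof (induction j)
  case (Suc j)
  have rec: "landau_coeff (Suc j) = landau_coeff j * ((2 * real j + 1) / (2 * (real j + 1)))"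
    by (simp add: landau_coeff_def gbinomial_Suc_rec field_simps gbinomial_absorption)
  have "(landau_coeff (Suc j))\<^sup>2 = (landau_coeff j)\<^sup>2 * ((2 * real j + 1) / (2 * (real j + 1)))\<^sup>2"
    by (simp only: rec power_mult_distrib)
  also have "\<dots> \<le> 1 / (real j + 1) * ((2 * real j + 1) / (2 * (real j + 1)))\<^sup>2"
    by (intro mult_right_mono Suc.IH) auto
  also have "\<dots> = (2 * real j + 1)\<^sup>2 / (4 * (real j + 1) ^ 3)"
    by (simp add: power2_eq_square power3_eq_cube field_simps)
  \<comment> \<open>Clearing denominators leaves
    \<open>(2 * j + 1)^2 * (j + 2) \<le> 4 * (j + 1)^3\<close>, whose two sides differ by
    \<open>3 * j + 2\<close>.\<close>
  also have "\<dots> \<le> 1 / (real (Suc j) + 1)"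
    by (simp add: divide_simps) (simp add: power2_eq_square power3_eq_cube algebra_simps)
  finally show ?case .
qed (simp add: landau_coeff_def)

lemma sum_landau_coeff_sq_le: "(\<Sum>j\<le>q. (landau_coeff j)\<^sup>2) \<le> 1 + ln (real q + 1)"
proof (induction q)
  case (Suc q)
  have "(landau_coeff (Suc q))\<^sup>2 \<le> 1 / (real q + 2)"
    using landau_coeff_sq_le[of "Suc q"] by (simp add: add_ac)
  \<comment> \<open>The new term is compared with the increment of the logarithm, so that the bounds
    telescope.\<close>
  also have "\<dots> \<le> ln (real q + 2) - ln (real q + 1)"
  proof -
    have "ln ((real q + 1) / (real q + 2)) \<le> (real q + 1) / (real q + 2) - 1"
      by (intro ln_le_minus_one) auto
    also have "\<dots> = - 1 / (real q + 2)" by (simp add: field_simps)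
    finally show ?thesis by (simp add: ln_div)
  qed
  finally show ?case using Suc.IH by (simp add: add_ac)
qed (simp add: landau_coeff_def)

text \<open>Averaging over the \<open>m\<close>-th roots of unity replaces integration over the
  circle, so that Landau's argument needs only finite sums.\<close>

lemma sum_roots_of_unity_power:
  assumes "m > 0"
  shows "(\<Sum>l<m. cis (2 * pi * real l / real m) ^ d) = (if m dvd d then of_nat m else 0)"
proof -
  define z where "z = cis (2 * pi * real d / real m)"
  have eq: "cis (2 * pi * real l / real m) ^ d = z ^ l" for l
    unfolding z_def Complex.DeMoivre by (rule arg_cong[of _ _ cis]) (simp add: field_simps)
  have zm: "z ^ m = 1"
    using assms by (simp add: z_def Complex.DeMoivre cis_multiple_2pi)
  show ?thesis
  proof (cases "m dvd d")
    case True
    then obtain e where "d = m * e" by blast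
    then have "2 * pi * real d / real m = 2 * pi * real e" using assms by simp
    then have "z = cis (2 * pi * real e)" by (simp only: z_def)
    then have "z = 1" by (simp only: cis_multiple_2pi Ints_of_nat)
    then show ?thesis using True by (simp add: eq)
  next
    case False
    have "z \<noteq> 1"
    proof
      assume "z = 1"
      then obtain x :: int where "2 * pi * real d / real m = 2 * pi * of_int x"
        by (auto simp: z_def complex_eq_iff cos_one_2pi_int mult_ac)
      then have "real d = real m * of_int x" using assms by (simp add: field_simps)
      then have "int d = int m * x" by (metis of_int_eq_iff of_int_mult of_int_of_nat_eq)
      then show False using False by (metis dvd_triv_left int_dvd_int_iff)
    qed
    then show ?thesis using False geometric_sum[of z m] zm by (simp add: eq)
  qed
qed

lemma triple_sum_product:
  fixes x :: "'i \<Rightarrow> 'a::comm_semiring_0" and y :: "'j \<Rightarrow> 'a" and z :: "'k \<Rightarrow> 'a"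
  shows "sum x I * sum y J * sum z K * v = (\<Sum>i\<in>I. \<Sum>j\<in>J. \<Sum>k\<in>K. x i * y j * z k * v)"
proof -
  have "u * sum y J * r = (\<Sum>j\<in>J. u * y j * r)" for u r
    by (simp add: sum_distrib_left sum_distrib_right)
  moreover have "u * sum z K * r = (\<Sum>k\<in>K. u * z k * r)" for u r
    by (simp add: sum_distrib_left sum_distrib_right)
  ultimately show ?thesis
    by (simp only: sum_distrib_right[of x I] sum_distrib_right[of "\<lambda>i. _ i * _ i" I] mult.assoc)
       (simp add: sum_distrib_left sum_distrib_right mult.assoc)
qed

text \<open>
  With \<open>K w = (\<Sum>j\<le>q. landau_coeff j * w ^ j)\<close>, the first \<open>q + 1\<close> coefficients of \<open>K\<^sup>2\<close> are
  all \<open>1\<close>; so the partial sum is the coefficient of \<open>w ^ q\<close> in \<open>G * K\<^sup>2\<close>, and it is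
  at most the supremum of \<open>G\<close> times the mean square of \<open>K\<close>.
\<close>

lemma landau_partial_sum_le:
  fixes c :: "'a \<Rightarrow> complex" and e :: "'a \<Rightarrow> nat"
  assumes fin: "finite I"
    and bound: "\<And>w. norm w = 1 \<Longrightarrow> norm (\<Sum>i\<in>I. c i * w ^ e i) \<le> A"
  shows "norm (\<Sum>i\<in>{i\<in>I. e i \<le> q}. c i) \<le> A * (1 + ln (real q + 1))"
proof -
  \<comment> \<open>\<open>m\<close> exceeds every degree occurring in \<open>G * K^2\<close>, so
    averaging over the \<open>m\<close>-th roots of unity isolates coefficients exactly.\<close>
  define m where "m = Suc (2 * q + (\<Sum>i\<in>I. e i))"
  have em: "e i + 2 * q < m" if "i \<in> I" for i
    using member_le_sum[OF that, of e] fin by (simp add: m_def)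
  have m0: "m > 0" and qm: "q < m" by (auto simp: m_def)
  define z where "z l = cis (2 * pi * real l / real m)" for l
  have nz: "norm (z l) = 1" for l by (simp add: z_def)
  define b where "b j = complex_of_real (landau_coeff j)" for j
  define G where "G w = (\<Sum>i\<in>I. c i * w ^ e i)" for w
  define K where "K w = (\<Sum>j\<le>q. b j * w ^ j)" for w
  have orth: "(\<Sum>l<m. z l ^ d * cnj (z l) ^ d') = (if d = d' then of_nat m else 0)"
    if "d < m" "d' < m" for d d'
  proof -
    have inv: "z l ^ k * cnj (z l) ^ k = 1" for l k
      by (simp flip: power_mult_distrib complex_norm_square add: nz)
    show ?thesis
    proof (cases "d' \<le> d")
      case True
      have "z l ^ d * cnj (z l) ^ d' = z l ^ (d - d')" for l
      proof -
        have "z l ^ d = z l ^ (d - d') * z l ^ d'" using True by (simp flip: power_add)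
        then show ?thesis by (simp only: mult.assoc inv mult_1_right)
      qed
      then show ?thesis
        using sum_roots_of_unity_power[OF m0, of "d - d'"] that True
        by (auto simp: z_def dest: dvd_imp_le)
    next
      case False
      have "z l ^ d * cnj (z l) ^ d' = cnj (z l ^ (d' - d))" for l
      proof -
        have "cnj (z l) ^ d' = cnj (z l) ^ d * cnj (z l) ^ (d' - d)" using False by (simp flip: power_add)
        then show ?thesis by (simp only: mult.assoc[symmetric] inv mult_1_left complex_cnj_power)
      qed
      then have "(\<Sum>l<m. z l ^ d * cnj (z l) ^ d') = cnj (\<Sum>l<m. z l ^ (d' - d))" by simp
      then show ?thesis
        using sum_roots_of_unity_power[OF m0, of "d' - d"] that False
        by (auto simp: z_def dest: dvd_imp_le)
    qed
  qed
  \<comment> \<open>This is the coefficient of \<open>w ^ (q - e i)\<close> in \<open>K^2\<close>,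
    which is \<open>1\<close> by the convolution identity; no term contributes when
    \<open>e i > q\<close>.\<close>
  have conv: "(\<Sum>j\<le>q. \<Sum>j'\<le>q. if e i + j + j' = q then b j * b j' else 0) = (if e i \<le> q then 1 else 0)" for i
  proof (cases "e i \<le> q")
    case True
    have "(\<Sum>j\<le>q. \<Sum>j'\<le>q. if e i + j + j' = q then b j * b j' else 0)
        = (\<Sum>j\<le>q. if j \<le> q - e i then b j * b (q - e i - j) else 0)"
    proof (rule sum.cong[OF refl])
      fix j assume "j \<in> {..q}"
      show "(\<Sum>j'\<le>q. if e i + j + j' = q then b j * b j' else 0)
          = (if j \<le> q - e i then b j * b (q - e i - j) else 0)"
      proof (cases "j \<le> q - e i")
        case j: True
        have "(\<Sum>j'\<le>q. if e i + j + j' = q then b j * b j' else 0)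
            = (\<Sum>j'\<le>q. if j' = q - e i - j then b j * b j' else 0)"
          by (rule sum.cong) (use j True in auto)
        then show ?thesis using j by simp
      next
        case False
        then show ?thesis using True by (auto intro!: sum.neutral)
      qed
    qed
    also have "\<dots> = (\<Sum>j\<in>{j\<in>{..q}. j \<le> q - e i}. b j * b (q - e i - j))"
      by (subst sum.inter_filter) auto
    also have "{j\<in>{..q}. j \<le> q - e i} = {..q - e i}" by auto
    also have "(\<Sum>j\<le>q - e i. b j * b (q - e i - j)) = 1"
      using arg_cong[OF landau_coeff_convolution[of "q - e i"], of complex_of_real] by (simp add: b_def)
    finally show ?thesis using True by simp
  qed (auto intro!: sum.neutral)
  have "(\<Sum>l<m. G (z l) * K (z l) * K (z l) * cnj (z l) ^ q)
      = (\<Sum>l<m. \<Sum>i\<in>I. \<Sum>j\<le>q. \<Sum>j'\<le>q. c i * b j * b j' * (z l ^ (e i + j + j') * cnj (z l) ^ q))"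
    unfolding G_def K_def triple_sum_product by (simp add: mult_ac power_add)
  also have "\<dots> = (\<Sum>i\<in>I. \<Sum>j\<le>q. \<Sum>j'\<le>q. c i * b j * b j' * (\<Sum>l<m. z l ^ (e i + j + j') * cnj (z l) ^ q))"
    unfolding sum_distrib_left
    by (simp only: sum.swap[of _ _ "{..<m}"])
  also have "\<dots> = (\<Sum>i\<in>I. \<Sum>j\<le>q. \<Sum>j'\<le>q. c i * b j * b j' * (if e i + j + j' = q then of_nat m else 0))"
    by (intro sum.cong refl arg_cong2[where f="(*)"] orth) (use em qm in fastforce)+
  also have "\<dots> = (\<Sum>i\<in>I. of_nat m * c i * (\<Sum>j\<le>q. \<Sum>j'\<le>q. if e i + j + j' = q then b j * b j' else 0))"
    unfolding sum_distrib_left by (intro sum.cong refl) auto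
  also have "\<dots> = of_nat m * (\<Sum>i\<in>{i\<in>I. e i \<le> q}. c i)"
    using fin by (simp add: conv sum.inter_filter sum_distrib_left if_distrib cong: if_cong)
  finally have main: "of_nat m * (\<Sum>i\<in>{i\<in>I. e i \<le> q}. c i) = (\<Sum>l<m. G (z l) * K (z l) * K (z l) * cnj (z l) ^ q)" ..
  \<comment> \<open>Parseval's identity for \<open>K\<close>, whose coefficients are real.\<close>
  have "(\<Sum>l<m. K (z l) * cnj (K (z l)))
      = (\<Sum>l<m. \<Sum>j\<le>q. \<Sum>j'\<le>q. b j * b j' * (z l ^ j * cnj (z l) ^ j'))"
    unfolding K_def cnj_sum sum_product b_def by (simp add: mult_ac)
  also have "\<dots> = (\<Sum>j\<le>q. \<Sum>j'\<le>q. b j * b j' * (\<Sum>l<m. z l ^ j * cnj (z l) ^ j'))"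
    unfolding sum_distrib_left
    by (simp only: sum.swap[of _ _ "{..<m}"])
  also have "\<dots> = (\<Sum>j\<le>q. \<Sum>j'\<le>q. b j * b j' * (if j = j' then of_nat m else 0))"
    by (intro sum.cong refl arg_cong2[where f="(*)"] orth) (use qm in auto)
  also have "\<dots> = of_real (real m * (\<Sum>j\<le>q. (landau_coeff j)\<^sup>2))"
    by (simp add: if_distrib sum.delta sum_distrib_left b_def power2_eq_square mult_ac cong: if_cong)
  finally have "complex_of_real (\<Sum>l<m. (norm (K (z l)))\<^sup>2) = of_real (real m * (\<Sum>j\<le>q. (landau_coeff j)\<^sup>2))"
    by (simp only: complex_norm_square of_real_sum)
  then have K2: "(\<Sum>l<m. (norm (K (z l)))\<^sup>2) = real m * (\<Sum>j\<le>q. (landau_coeff j)\<^sup>2)"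
    using of_real_eq_iff by blast
  have A0: "A \<ge> 0" using bound[of 1] norm_ge_zero order_trans by (metis norm_one)
  have "real m * norm (\<Sum>i\<in>{i\<in>I. e i \<le> q}. c i) = norm (\<Sum>l<m. G (z l) * K (z l) * K (z l) * cnj (z l) ^ q)"
    using arg_cong[OF main, of norm] by (simp add: norm_mult)
  also have "\<dots> \<le> (\<Sum>l<m. A * (norm (K (z l)))\<^sup>2)"
    by (intro sum_norm_le)
       (simp add: norm_mult norm_power nz power2_eq_square mult.assoc G_def bound mult_right_mono)
  also have "\<dots> = real m * (A * (\<Sum>j\<le>q. (landau_coeff j)\<^sup>2))"
    by (simp add: K2 flip: sum_distrib_left)
  also have "\<dots> \<le> real m * (A * (1 + ln (real q + 1)))"
    by (intro mult_left_mono sum_landau_coeff_sq_le A0) auto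
  finally show ?thesis using m0 by simp
qed

section \<open>Short integer solutions of linear inequalities\<close>

text \<open>Dirichlet's box principle: the box \<open>X\<close> has more points than there are
  possible vectors of values, so two of its points share their image, and their difference is the
  required vector.\<close>

lemma siegel:
  fixes e :: "'b \<Rightarrow> 'a \<Rightarrow> int"
  assumes fin: "finite V" "finite E" and less: "card E < card V"
    and M: "\<And>i v. i \<in> E \<Longrightarrow> v \<in> V \<Longrightarrow> \<bar>e i v\<bar> \<le> int M" "M > 0"
  shows "\<exists>z. (\<exists>v\<in>V. z v \<noteq> 0) \<and> (\<forall>i\<in>E. (\<Sum>v\<in>V. e i v * z v) = 0) \<and>
           (\<forall>v\<in>V. \<bar>z v\<bar> \<le> int ((2 * card V * M) ^ card E))"
proof -
  define n where "n = card V"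
  define B where "B = (2 * n * M) ^ card E"
  define X where "X = PiE V (\<lambda>_. {0..int B})"
  define F where "F x = restrict (\<lambda>i. \<Sum>v\<in>V. e i v * x v) E" for x
  define Y where "Y = PiE E (\<lambda>_. {- int (n * M * B)..int (n * M * B)})"
  have n0: "n > 0" using less by (simp add: n_def)
  have sub: "F ` X \<subseteq> Y"
  proof
    fix f assume "f \<in> F ` X"
    then obtain x where x: "x \<in> X" and f: "f = F x" by blast
    have "\<bar>\<Sum>v\<in>V. e i v * x v\<bar> \<le> int (n * M * B)" if "i \<in> E" for i
    proof -
      have "\<bar>\<Sum>v\<in>V. e i v * x v\<bar> \<le> (\<Sum>v\<in>V. int M * int B)"
        using M(1)[OF that] x
        by (intro sum_abs[THEN order_trans] sum_mono) (auto simp: abs_mult X_def PiE_iff intro!: mult_mono)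
      then show ?thesis by (simp add: n_def)
    qed
    then show "f \<in> Y" by (auto simp: f F_def Y_def abs_le_iff minus_le_iff)
  qed
  have cX: "card X = (B + 1) ^ n"
    using fin by (simp add: X_def card_PiE n_def nat_add_distrib)
  \<comment> \<open>The side \<open>B\<close> is chosen to absorb the factor
    \<open>(2 * n * M) ^ card E\<close> that appears here.\<close>
  have "card Y = (2 * (n * M * B) + 1) ^ card E"
    using fin by (simp add: Y_def card_PiE nat_add_distrib nat_mult_distrib mult_ac)
  also have "\<dots> \<le> ((2 * n * M) * (B + 1)) ^ card E"
    using n0 M(2) by (intro power_mono) (auto simp: algebra_simps)
  also have "\<dots> = B * (B + 1) ^ card E" by (simp only: power_mult_distrib[of "2 * n * M"] B_def)
  also have "\<dots> < (B + 1) ^ Suc (card E)" by simp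
  also have "\<dots> \<le> (B + 1) ^ n" using less by (intro power_increasing) (auto simp: n_def)
  finally have "card Y < card X" by (simp only: cX)
  moreover have "finite Y" using fin by (auto simp: Y_def intro!: finite_PiE)
  ultimately have "\<not> inj_on F X"
    using card_inj_on_le[OF _ sub] by fastforce
  then obtain x y where xy: "x \<in> X" "y \<in> X" "F x = F y" "x \<noteq> y" by (auto simp: inj_on_def)
  show ?thesis
  proof (intro exI[of _ "\<lambda>v. x v - y v"] conjI ballI)
    show "\<exists>v\<in>V. x v - y v \<noteq> 0"
      using xy by (metis X_def PiE_ext right_minus_eq)
    show "(\<Sum>v\<in>V. e i v * (x v - y v)) = 0" if "i \<in> E" for i
      using fun_cong[OF xy(3), of i] that by (simp add: F_def right_diff_distrib sum_subtractf)
    show "\<bar>x v - y v\<bar> \<le> int ((2 * card V * M) ^ card E)" if "v \<in> V" for v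
    proof -
      have "x v \<in> {0..int B}" "y v \<in> {0..int B}" using xy that by (auto simp: X_def)
      then show ?thesis unfolding B_def n_def atLeastAtMost_iff by linarith
    qed
  qed
qed

text \<open>The nonzero solution \<open>y\<close> keeps the rank below \<open>card V\<close>, so
  fewer than \<open>card V\<close> of the equations imply all of them, even when \<open>E\<close> is
  infinite. The induction is Gaussian elimination, removing one unknown with one pivot equation at a
  time.\<close>

lemma small_subfamily_same_kernel:
  fixes e :: "'b \<Rightarrow> 'a \<Rightarrow> real"
  assumes "finite V" and "\<And>i. i \<in> E \<Longrightarrow> (\<Sum>v\<in>V. e i v * y v) = 0" and "\<exists>v\<in>V. y v \<noteq> 0"
  shows "\<exists>E'\<subseteq>E. finite E' \<and> card E' < card V \<and>
           (\<forall>z. (\<forall>i\<in>E'. (\<Sum>v\<in>V. e i v * z v) = 0) \<longrightarrow> (\<forall>i\<in>E. (\<Sum>v\<in>V. e i v * z v) = 0))"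
  using assms
proof (induction "card V" arbitrary: V e)
  case 0
  then show ?case by auto
next
  case (Suc n)
  show ?case
  proof (cases "\<forall>i\<in>E. \<forall>v\<in>V. e i v = 0")
    case True
    then show ?thesis using Suc.hyps by (intro exI[of _ "{}"]) auto
  next
    case False
    then obtain i0 v0 where i0: "i0 \<in> E" "v0 \<in> V" "e i0 v0 \<noteq> 0" by blast
    define W where "W = V - {v0}"
    \<comment> \<open>Subtracting a multiple of the pivot equation \<open>i0\<close> cancels the
      coefficient of \<open>v0\<close>, so the reduced equations involve only
      \<open>W\<close>.\<close>
    define d where "d i v = e i v - e i v0 / e i0 v0 * e i0 v" for i v
    have V: "V = insert v0 W" "v0 \<notin> W" "finite W" using i0 Suc.prems(1) by (auto simp: W_def)
    have red: "(\<Sum>v\<in>V. e i v * z v) = (\<Sum>v\<in>W. d i v * z v)"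
      if "(\<Sum>v\<in>V. e i0 v * z v) = 0" for i z
    proof -
      have "e i0 v0 * z v0 = - (\<Sum>v\<in>W. e i0 v * z v)"
        using that V by simp
      then have "z v0 = - (\<Sum>v\<in>W. e i0 v * z v) / e i0 v0"
        using i0(3) by (metis nonzero_mult_div_cancel_left)
      then have "e i v0 * z v0 = - (e i v0 / e i0 v0 * (\<Sum>v\<in>W. e i0 v * z v))"
        using i0(3) by simp
      then show ?thesis
        using V by (simp add: d_def left_diff_distrib sum_subtractf sum_distrib_left mult.assoc)
    qed
    have y0: "(\<Sum>v\<in>V. e i0 v * y v) = 0" using Suc.prems(2) i0 by blast
    have "\<exists>v\<in>W. y v \<noteq> 0"
    proof (rule ccontr)
      assume "\<not> ?thesis"
      then have W0: "y v = 0" if "v \<in> W" for v using that by blast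
      then have "y v0 = 0" using y0 V i0(3) by simp
      then show False using Suc.prems(3) V(1) W0 by auto
    qed
    moreover have "n = card W" using Suc.hyps(2) V by simp
    moreover have "(\<Sum>v\<in>W. d i v * y v) = 0" if "i \<in> E" for i
      using red[OF y0] Suc.prems(2)[OF that] by simp
    ultimately have "\<exists>E'\<subseteq>E. finite E' \<and> card E' < card W \<and>
        (\<forall>z. (\<forall>i\<in>E'. (\<Sum>v\<in>W. d i v * z v) = 0) \<longrightarrow> (\<forall>i\<in>E. (\<Sum>v\<in>W. d i v * z v) = 0))"
      using V(3) by (intro Suc.hyps(1))
    then obtain E' where E': "E' \<subseteq> E" "finite E'" "card E' < card W"
      and E'_kernel: "\<forall>z. (\<forall>i\<in>E'. (\<Sum>v\<in>W. d i v * z v) = 0) \<longrightarrow> (\<forall>i\<in>E. (\<Sum>v\<in>W. d i v * z v) = 0)"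
      by (elim exE conjE)
    have "card (insert i0 E') < card V"
      using E'(2,3) V by (simp add: card_insert_if)
    moreover have "\<forall>i\<in>E. (\<Sum>v\<in>V. e i v * z v) = 0"
      if "\<forall>i\<in>insert i0 E'. (\<Sum>v\<in>V. e i v * z v) = 0" for z
    proof -
      have z0: "(\<Sum>v\<in>V. e i0 v * z v) = 0" using that by blast
      have "\<forall>i\<in>E'. (\<Sum>v\<in>W. d i v * z v) = 0" using that red[OF z0] by simp
      from E'_kernel[rule_format, OF this[rule_format]] show ?thesis using red[OF z0] by simp
    qed
    moreover have "insert i0 E' \<subseteq> E" "finite (insert i0 E')" using E' i0 by auto
    ultimately show ?thesis by (intro exI[of _ "insert i0 E'"] conjI allI impI)
  qed
qed

text \<open>
  A normalised solution with the largest possible set of tight constraints is determined up to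
  scaling by those constraints; hence a short integer vector in their kernel is a multiple of it.
\<close>

lemma short_integer_solution:
  fixes e :: "'b \<Rightarrow> 'a \<Rightarrow> int" and y :: "'a \<Rightarrow> real"
  assumes fin: "finite V" "finite E" and h: "h \<in> V" "y h > 0"
    and M: "\<And>i v. i \<in> E \<Longrightarrow> v \<in> V \<Longrightarrow> \<bar>e i v\<bar> \<le> int M" "M > 0"
    and coord: "\<And>v. v \<in> V \<Longrightarrow> \<exists>i\<in>E. \<forall>u\<in>V. e i u = (if u = v then 1 else 0)"
    and y: "\<And>i. i \<in> E \<Longrightarrow> (\<Sum>v\<in>V. of_int (e i v) * y v) \<ge> 0"
  obtains z :: "'a \<Rightarrow> int" where "z h \<ge> 1" "\<And>i. i \<in> E \<Longrightarrow> (\<Sum>v\<in>V. e i v * z v) \<ge> 0"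
    "\<And>v. v \<in> V \<Longrightarrow> 0 \<le> z v" "\<And>v. v \<in> V \<Longrightarrow> z v \<le> int ((2 * card V * M) ^ (card V - 1))"
proof -
  define L where "L i x = (\<Sum>v\<in>V. real_of_int (e i v) * x v)" for i and x :: "'a \<Rightarrow> real"
  have L_add: "L i (\<lambda>v. a v + t * b v) = L i a + t * L i b" for i a b t
    by (simp add: L_def distrib_left sum.distrib sum_distrib_left mult_ac)
  have L_coord: "\<exists>i\<in>E. \<forall>x. L i x = x v" if v: "v \<in> V" for v
  proof -
    obtain i where i: "i \<in> E" "\<forall>u\<in>V. e i u = (if u = v then 1 else 0)" using coord[OF v] by blast
    have "L i x = (\<Sum>u\<in>V. if u = v then x u else 0)" for x
      unfolding L_def by (rule sum.cong) (use i in auto)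
    then show ?thesis using i v fin by auto
  qed
  define feas where "feas x \<longleftrightarrow> x h = 1 \<and> (\<forall>i\<in>E. L i x \<ge> 0)" for x
  define tight where "tight x = {i\<in>E. L i x = 0}" for x
  \<comment> \<open>Rescaling \<open>y\<close> meets the normalisation at \<open>h\<close>; the
    summand \<open>0\<close> only gives the vector the form that \<open>L_add\<close>
    expects.\<close>
  have "feas (\<lambda>v. 0 + inverse (y h) * y v)"
    unfolding feas_def L_add using y h by (simp add: L_def)
  moreover have "\<forall>x. feas x \<longrightarrow> card (tight x) < Suc (card E)"
    using fin by (auto simp: tight_def less_Suc_eq_le intro!: card_mono)
  ultimately obtain x where x: "feas x" and max: "\<And>x'. feas x' \<Longrightarrow> card (tight x') \<le> card (tight x)"
    using ex_has_greatest_nat[of feas _ "\<lambda>x. card (tight x)"] by metis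
  have xh: "x h = 1" and Lx: "\<And>i. i \<in> E \<Longrightarrow> L i x \<ge> 0" using x by (auto simp: feas_def)
  have x_nonneg: "x v \<ge> 0" if "v \<in> V" for v using L_coord[OF that] Lx by metis
  \<comment> \<open>If \<open>z\<close> were in the kernel of the tight constraints without being a
    multiple of \<open>x\<close>, one could move \<open>x\<close> along the difference, keeping
    coordinate \<open>h\<close> and the tight constraints, until another constraint becomes tight.
    This contradicts maximality.\<close>
  have kernel: "z v = z h * x v" if z: "\<And>i. i \<in> tight x \<Longrightarrow> L i z = 0" and v: "v \<in> V" for z v
  proof (rule ccontr)
    assume neq: "z v \<noteq> z h * x v"
    \<comment> \<open>The sign makes coordinate \<open>v\<close> of \<open>w\<close> negative, so
      some constraint decreases along \<open>w\<close>.\<close>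
    define s :: real where "s = (if z v < z h * x v then 1 else -1)"
    define w where "w u = s * (z u + (- z h) * x u)" for u
    have wL: "L i w = s * (L i z - z h * L i x)" for i
      using L_add[of i "\<lambda>_. 0" s "\<lambda>u. z u + (- z h) * x u"] L_add[of i z "- z h" x]
      by (simp add: w_def L_def)
    have wv: "w v < 0" using neq by (auto simp: w_def s_def)
    have wt: "L i w = 0" if "i \<in> tight x" for i
      using z[OF that] that by (simp add: wL tight_def)
    define Neg where "Neg = {i\<in>E. L i w < 0}"
    \<comment> \<open>\<open>r i\<close> is the step length at which constraint \<open>i\<close>
      becomes tight; the shortest such step violates no constraint.\<close>
    define r where "r i = L i x / (- L i w)" for i
    have "Neg \<noteq> {}" using L_coord[OF v] wv by (force simp: Neg_def)
    moreover have finN: "finite Neg" using fin by (simp add: Neg_def)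
    ultimately obtain i1 where i1: "i1 \<in> Neg" "\<And>i. i \<in> Neg \<Longrightarrow> r i1 \<le> r i"
      using ex_is_arg_min_if_finite[of Neg r] by (auto simp: is_arg_min_linorder)
    define x' where "x' u = x u + r i1 * w u" for u
    have Lx': "L i x' = L i x + r i1 * L i w" for i
      unfolding x'_def by (rule L_add)
    have r0: "r i1 \<ge> 0" using i1(1) Lx by (auto simp: r_def Neg_def intro!: divide_nonneg_neg)
    have "L i x' \<ge> 0" if "i \<in> E" for i
    proof (cases "i \<in> Neg")
      case True
      then have "r i1 * (- L i w) \<le> r i * (- L i w)" using i1(2) by (intro mult_right_mono) (auto simp: Neg_def)
      also have "\<dots> = L i x" using True by (auto simp: r_def Neg_def)
      finally show ?thesis by (simp add: Lx')
    next
      case False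
      then show ?thesis using r0 Lx[OF that] that by (auto simp: Lx' Neg_def)
    qed
    moreover have "x' h = 1" by (simp add: x'_def w_def xh)
    ultimately have "feas x'" by (simp add: feas_def)
    have "L i1 x' = 0" using i1(1) by (simp add: Lx' r_def Neg_def)
    then have "i1 \<in> tight x'" using i1(1) by (simp add: tight_def Neg_def)
    moreover have "i1 \<notin> tight x" using i1(1) wt by (force simp: Neg_def)
    moreover have "tight x \<subseteq> tight x'" using wt by (auto simp: tight_def Lx')
    ultimately have "tight x \<subset> tight x'" by blast
    then have "card (tight x) < card (tight x')"
      using fin by (intro psubset_card_mono) (auto simp: tight_def)
    with max[OF \<open>feas x'\<close>] show False by simp
  qed
  have "\<exists>E'\<subseteq>tight x. finite E' \<and> card E' < card V \<and>
      (\<forall>z. (\<forall>i\<in>E'. L i z = 0) \<longrightarrow> (\<forall>i\<in>tight x. L i z = 0))"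
    unfolding L_def
    by (rule small_subfamily_same_kernel[where y = x])
       (use fin h xh in \<open>auto simp: tight_def L_def intro!: bexI[of _ h]\<close>)
  then obtain E' where E': "E' \<subseteq> tight x" "finite E'" "card E' < card V"
    and E'_kernel: "\<forall>z. (\<forall>i\<in>E'. L i z = 0) \<longrightarrow> (\<forall>i\<in>tight x. L i z = 0)"
    by (elim exE conjE)
  have E'E: "E' \<subseteq> E" using E'(1) by (auto simp: tight_def)
  have ME': "\<bar>e i v\<bar> \<le> int M" if "i \<in> E'" "v \<in> V" for i v
    using M(1) E'E that by blast
  have "\<exists>z. (\<exists>v\<in>V. z v \<noteq> 0) \<and> (\<forall>i\<in>E'. (\<Sum>v\<in>V. e i v * z v) = 0) \<and>
           (\<forall>v\<in>V. \<bar>z v\<bar> \<le> int ((2 * card V * M) ^ card E'))"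
    by (rule siegel[OF fin(1) E'(2,3) _ M(2)]) (rule ME')
  then obtain z where z: "\<exists>v\<in>V. z v \<noteq> 0" "\<forall>i\<in>E'. (\<Sum>v\<in>V. e i v * z v) = 0"
    "\<forall>v\<in>V. \<bar>z v\<bar> \<le> int ((2 * card V * M) ^ card E')"
    by (elim exE conjE)
  have "L i (\<lambda>v. of_int (z v)) = of_int (\<Sum>v\<in>V. e i v * z v)" for i
    by (simp add: L_def)
  then have "\<forall>i\<in>E'. L i (\<lambda>v. of_int (z v)) = 0"
    using z(2) by (simp del: of_int_sum of_int_mult)
  then have "\<forall>i\<in>tight x. L i (\<lambda>v. of_int (z v)) = 0" by (rule E'_kernel[THEN spec, THEN mp]) 
  then have zx: "of_int (z v) = of_int (z h) * x v" if "v \<in> V" for v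
    by (intro kernel[OF _ that]) simp
  have zh: "z h \<noteq> 0"
  proof
    assume "z h = 0"
    then have "z v = 0" if "v \<in> V" for v using zx[OF that] by simp
    then show False using z(1) by simp
  qed
  \<comment> \<open>\<open>z\<close> is \<open>z h\<close> times \<open>x\<close> on
    \<open>V\<close>; after the change of sign the factor is positive, so the inequalities for
    \<open>x\<close> carry over.\<close>
  define z' where "z' v = sgn (z h) * z v" for v
  have z'x: "of_int (z' v) = of_int \<bar>z h\<bar> * x v" if "v \<in> V" for v
    unfolding z'_def of_int_mult zx[OF that] by (simp add: sgn_if)
  have bound: "int ((2 * card V * M) ^ card E') \<le> int ((2 * card V * M) ^ (card V - 1))"
    using E'(3) M(2) unfolding of_nat_le_iff by (intro power_increasing) (auto simp: Suc_le_eq)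
  show thesis
  proof
    show "z' h \<ge> 1" using zh by (auto simp: z'_def sgn_if)
    show "(\<Sum>v\<in>V. e i v * z' v) \<ge> 0" if "i \<in> E" for i
    proof -
      have "real_of_int (\<Sum>v\<in>V. e i v * z' v) = (\<Sum>v\<in>V. of_int \<bar>z h\<bar> * (of_int (e i v) * x v))"
        unfolding of_int_sum of_int_mult by (rule sum.cong) (use z'x in auto)
      also have "\<dots> = of_int \<bar>z h\<bar> * L i x" by (simp only: L_def sum_distrib_left)
      also have "\<dots> \<ge> 0" using Lx[OF that] by simp
      finally show ?thesis by linarith
    qed
    show "0 \<le> z' v" if "v \<in> V" for v
    proof -
      have "real_of_int (z' v) \<ge> 0" using z'x[OF that] x_nonneg[OF that] by simp
      then show ?thesis by linarith
    qed
    show "z' v \<le> int ((2 * card V * M) ^ (card V - 1))" if "v \<in> V" for v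
    proof -
      have "z' v \<le> \<bar>z v\<bar>" by (auto simp: z'_def sgn_if)
      then show ?thesis using z(3) that bound by fastforce
    qed
  qed
qed

section \<open>Bohr's correspondence\<close>

text \<open>A completely additive function. The value type is left open: natural weights serve as
  exponents of \<open>w\<close>, and real ones recover the logarithm.\<close>

definition additive_weight :: "(nat \<Rightarrow> 'a) \<Rightarrow> nat \<Rightarrow> 'a :: comm_semiring_1" where
  "additive_weight Q n = (\<Sum>p\<in>prime_factors n. of_nat (multiplicity p n) * Q p)"

lemma additive_weight_eq_sum:
  assumes "finite S" "prime_factors n \<subseteq> S" "\<And>p. p \<in> S \<Longrightarrow> prime p"
  shows "additive_weight Q n = (\<Sum>p\<in>S. of_nat (multiplicity p n) * Q p)"
  unfolding additive_weight_def
proof (rule sum.mono_neutral_left)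
  show "\<forall>p\<in>S - prime_factors n. of_nat (multiplicity p n) * Q p = 0"
    using assms(3) by (auto simp: prime_factors_multiplicity)
qed (use assms in auto)

lemma additive_weight_ln:
  assumes "n > 0"
  shows "additive_weight (\<lambda>p. ln (real p)) n = ln (real n)"
proof -
  have pos: "p > 0" if "p \<in> prime_factors n" for p
    using that in_prime_factors_imp_prime prime_gt_0_nat by blast
  have "ln (real n) = ln (real (\<Prod>p\<in>prime_factors n. p ^ multiplicity p n))"
    using prime_factorization_nat[OF assms] by simp
  also have "\<dots> = (\<Sum>p\<in>prime_factors n. ln (real p ^ multiplicity p n))"
    using pos by (simp add: ln_prod)
  also have "\<dots> = (\<Sum>p\<in>prime_factors n. real (multiplicity p n) * ln (real p))"
    using pos by (simp add: ln_realpow)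
  finally show ?thesis by (simp add: additive_weight_def)
qed

lemma additive_weight_mult:
  assumes "m > 0" "n > 0"
  shows "additive_weight Q (m * n) = additive_weight Q m + additive_weight Q n"
proof -
  define S where "S = prime_factors (m * n)"
  have eq: "additive_weight Q k = (\<Sum>p\<in>S. of_nat (multiplicity p k) * Q p)"
    if "k \<in> {m, n, m * n}" for k
    by (rule additive_weight_eq_sum) (use assms that in \<open>auto simp: S_def prime_factors_product\<close>)
  have "multiplicity p (m * n) = multiplicity p m + multiplicity p n" if "p \<in> S" for p
    using that assms by (intro prime_elem_multiplicity_mult_distrib) (auto simp: S_def)
  then show ?thesis by (simp add: eq distrib_right sum.distrib)
qed

text \<open>Separating positive from negative coefficients turns the relation into an equality of
  two products of prime powers; unique factorisation then makes the exponents agree.\<close>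

lemma ln_primes_independent:
  fixes u :: "nat \<Rightarrow> int"
  assumes fin: "finite S" and pr: "\<And>p. p \<in> S \<Longrightarrow> prime p"
    and sum0: "(\<Sum>p\<in>S. of_int (u p) * ln (real p)) = 0" and "q \<in> S"
  shows "u q = 0"
proof -
  have pos: "p > 0" if "p \<in> S" for p using pr[OF that] by (simp add: prime_gt_0_nat)
  define X where "X g = (\<Prod>p\<in>S. p ^ g p)" for g :: "nat \<Rightarrow> nat"
  have X0: "X g > 0" for g using pos by (simp add: X_def prod_pos)
  have lnX: "ln (real (X g)) = (\<Sum>p\<in>S. real (g p) * ln (real p))" for g
    using pos fin by (simp add: X_def ln_prod ln_realpow)
  have mult: "multiplicity q (X g) = g q" for g
  proof -
    have "multiplicity q (X g) = (\<Sum>p\<in>S. multiplicity q (p ^ g p))"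
      unfolding X_def using pr[OF \<open>q \<in> S\<close>] pos[of 0] fin
      by (intro prime_elem_multiplicity_prod_distrib) auto
    also have "\<dots> = (\<Sum>p\<in>S. if p = q then g q else 0)"
      by (rule sum.cong) (use pr \<open>q \<in> S\<close> in \<open>auto simp: multiplicity_distinct_prime_power\<close>)
    also have "\<dots> = g q" using \<open>q \<in> S\<close> fin by simp
    finally show ?thesis .
  qed
  have "real (nat (u p)) - real (nat (- u p)) = of_int (u p)" for p
    by (cases "u p \<ge> 0") auto
  then have "ln (real (X (\<lambda>p. nat (u p)))) - ln (real (X (\<lambda>p. nat (- u p)))) = 0"
    using sum0 by (simp only: lnX flip: sum_subtractf left_diff_distrib)
  then have "X (\<lambda>p. nat (u p)) = X (\<lambda>p. nat (- u p))"
    using X0 by simp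
  then have "nat (u q) = nat (- u q)" using mult by metis
  then show ?thesis by linarith
qed

text \<open>This is Kronecker's theorem for the numbers \<open>ln p\<close>, which are independent
  over the integers; \<open>f\<close> enumerates \<open>S\<close> to match its indexing.\<close>

lemma kronecker_ln_primes:
  fixes \<alpha> :: "nat \<Rightarrow> real"
  assumes fin: "finite S" and pr: "\<And>p. p \<in> S \<Longrightarrow> prime p" and "\<epsilon> > 0"
  shows "\<exists>t h. \<forall>p\<in>S. \<bar>t * ln (real p) - of_int (h p) - \<alpha> p\<bar> < \<epsilon>"
proof -
  obtain f where f: "bij_betw f {..<card S} S"
    using ex_bij_betw_nat_finite[OF fin] by (auto simp: atLeast0LessThan)
  define \<theta> where "\<theta> i = ln (real (f i))" for i
  have img: "\<theta> ` {..<card S} = (\<lambda>p. ln (real p)) ` S"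
  proof -
    have "\<theta> ` {..<card S} = (\<lambda>p. ln (real p)) ` (f ` {..<card S})"
      by (simp add: \<theta>_def image_image)
    then show ?thesis using bij_betw_imp_surj_on[OF f] by simp
  qed
  have ln_inj: "inj_on (\<lambda>p. ln (real p)) S"
    using pr by (auto simp: inj_on_def prime_gt_0_nat)
  have mod: "Modules.module (\<lambda>r. (*) (real_of_int r))"
    by (simp add: Modules.module.intro distrib_left mult.commute)
  have "module.independent (\<lambda>r. (*) (real_of_int r)) (\<theta> ` {..<card S})"
    unfolding module.independent_explicit_module[OF mod]
  proof (intro allI impI)
    fix T u v assume T: "finite T" "T \<subseteq> \<theta> ` {..<card S}" "(\<Sum>v\<in>T. real_of_int (u v) * v) = 0" "v \<in> T"
    from T(2) obtain S' where S': "S' \<subseteq> S" "T = (\<lambda>p. ln (real p)) ` S'"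
      unfolding img by (auto simp: subset_image_iff)
    have inj': "inj_on (\<lambda>p. ln (real p)) S'" using ln_inj S'(1) inj_on_subset by blast
    have "(\<Sum>p\<in>S'. of_int (u (ln (real p))) * ln (real p)) = 0"
      using T(3) unfolding S'(2) by (simp add: sum.reindex[OF inj'])
    moreover obtain q where "q \<in> S'" "v = ln (real q)" using T(4) S'(2) by blast
    ultimately show "u v = 0"
      using ln_primes_independent[of S' "\<lambda>p. u (ln (real p))" q] S'(1) pr fin
      by (metis finite_subset subsetD)
  qed
  moreover have "inj_on \<theta> {..<card S}"
    using comp_inj_on[of f "{..<card S}" "\<lambda>p. ln (real p)"] f ln_inj
    by (simp add: bij_betw_def \<theta>_def[abs_def] o_def)
  ultimately obtain t h where th: "\<And>i. i < card S \<Longrightarrow> \<bar>t * \<theta> i - of_int (h i) - \<alpha> (f i)\<bar> < \<epsilon>"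
    using Kronecker_thm_1[of \<theta> "card S" \<epsilon> "\<lambda>i. \<alpha> (f i)"] \<open>\<epsilon> > 0\<close> by metis
  define g where "g = inv_into {..<card S} f"
  have "f (g p) = p" "g p < card S" if "p \<in> S" for p
    using that bij_betw_imp_surj_on[OF f] inv_into_into[of p f "{..<card S}"] f_inv_into_f[of p f "{..<card S}"]
    by (auto simp: g_def)
  then show ?thesis
    using th by (intro exI[of _ t] exI[of _ "\<lambda>p. h (g p)"]) (metis \<theta>_def)
qed

text \<open>A chord is no longer than its arc. The free integer \<open>k\<close> is there because
  Kronecker's theorem controls angles only up to full turns.\<close>

lemma norm_cis_diff_le: "norm (cis x - cis y) \<le> \<bar>x - y - 2 * pi * of_int k\<bar>"
proof -
  define u where "u = x - y - 2 * pi * of_int k"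
  have "cis x = cis y * cis u * cis (2 * pi * of_int k)"
    by (simp only: cis_mult u_def) simp
  then have "cis x = cis y * cis u" by simp
  then have "norm (cis x - cis y) = norm (cis y * (cis u - 1))"
    by (simp add: right_diff_distrib)
  also have "\<dots> = norm (exp (\<i> * of_real u) - 1)"
    by (simp add: norm_mult cis_conv_exp)
  also have "\<dots> \<le> \<bar>u\<bar>"
    unfolding dist_exp_i_1 using abs_sin_x_le_abs_x[of "u / 2"] by simp
  finally show ?thesis by (simp add: u_def)
qed

text \<open>A single vertical shift brings every \<open>p powr (- \<i> * s)\<close> close to
  \<open>w ^ Q p\<close>. Complete additivity extends this to all \<open>n\<close> in
  \<open>I\<close>, with an error proportional to the number of prime factors of \<open>n\<close>.
  So the value at \<open>w\<close> is a limit of values on the vertical line.\<close>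

lemma dirichlet_polynomial_bohr:
  fixes b :: "nat \<Rightarrow> complex" and Q :: "nat \<Rightarrow> nat"
  assumes fin: "finite I" and pos: "\<And>n. n \<in> I \<Longrightarrow> n > 0"
    and bound: "\<And>t. norm (\<Sum>n\<in>I. b n * cis (- t * ln (real n))) \<le> A"
    and w: "norm w = 1"
  shows "norm (\<Sum>n\<in>I. b n * w ^ additive_weight Q n) \<le> A"
proof (rule field_le_epsilon)
  fix \<delta> :: real assume \<delta>: "\<delta> > 0"
  obtain \<phi> where \<phi>: "w = cis \<phi>" using w by (metis complex_norm_eq_1_exp cis_conv_exp)
  define S where "S = (\<Union>n\<in>I. prime_factors n)"
  define \<Omega> where "\<Omega> n = (\<Sum>p\<in>S. real (multiplicity p n))" for n
  define B where "B = (\<Sum>n\<in>I. norm (b n) * (2 * pi * \<Omega> n))"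
  have B0: "B \<ge> 0" by (auto simp: B_def \<Omega>_def intro!: sum_nonneg mult_nonneg_nonneg)
  \<comment> \<open>Dividing by \<open>B + 1\<close> instead of \<open>B\<close> also covers the
    case \<open>B = 0\<close>.\<close>
  define \<epsilon> where "\<epsilon> = \<delta> / (B + 1)"
  have \<epsilon>: "\<epsilon> > 0" using \<delta> B0 by (simp add: \<epsilon>_def)
  have S: "finite S" "\<And>p. p \<in> S \<Longrightarrow> prime p" using fin by (auto simp: S_def)
  \<comment> \<open>The targets are chosen so that, with \<open>s = 2 * pi * t\<close>, the angle
    \<open>- s * ln p\<close> is close to \<open>\<phi> * Q p\<close> up to full turns.\<close>
  obtain t h where th: "\<forall>p\<in>S. \<bar>t * ln (real p) - of_int (h p) - (- \<phi> * real (Q p) / (2 * pi))\<bar> < \<epsilon>"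
    using kronecker_ln_primes[OF S \<epsilon>, of "\<lambda>p. - \<phi> * real (Q p) / (2 * pi)"] by blast
  define s where "s = 2 * pi * t"
  have step: "norm (w ^ additive_weight Q n - cis (- s * ln (real n))) \<le> 2 * pi * \<Omega> n * \<epsilon>" if n: "n \<in> I" for n
  proof -
    have sub: "prime_factors n \<subseteq> S" using n by (auto simp: S_def)
    have wt: "additive_weight Q n = (\<Sum>p\<in>S. multiplicity p n * Q p)"
      using additive_weight_eq_sum[OF S(1) sub S(2), of Q] by simp
    have lnn: "ln (real n) = (\<Sum>p\<in>S. real (multiplicity p n) * ln (real p))"
      using additive_weight_eq_sum[OF S(1) sub S(2), of "\<lambda>p. ln (real p)"]
        additive_weight_ln[OF pos[OF n]] by simp
    define k where "k = - (\<Sum>p\<in>S. int (multiplicity p n) * h p)"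
    have "norm (w ^ additive_weight Q n - cis (- s * ln (real n)))
        = norm (cis (real (additive_weight Q n) * \<phi>) - cis (- s * ln (real n)))"
      by (simp add: \<phi> Complex.DeMoivre)
    also have "\<dots> \<le> \<bar>real (additive_weight Q n) * \<phi> - (- s * ln (real n)) - 2 * pi * of_int (- k)\<bar>"
      by (rule norm_cis_diff_le)
    also have "real (additive_weight Q n) * \<phi> - (- s * ln (real n)) - 2 * pi * of_int (- k)
        = (\<Sum>p\<in>S. 2 * pi * (real (multiplicity p n) *
            (t * ln (real p) - of_int (h p) - (- \<phi> * real (Q p) / (2 * pi)))))"
      unfolding wt lnn k_def s_def
      by (simp add: sum_distrib_left sum_distrib_right sum.distrib[symmetric] sum_subtractf[symmetric] sum_negf[symmetric])
         (intro sum.cong refl, simp add: field_simps)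
    also have "\<bar>\<dots>\<bar> \<le> (\<Sum>p\<in>S. 2 * pi * (real (multiplicity p n) * \<epsilon>))"
    proof (intro sum_abs[THEN order_trans] sum_mono)
      fix p assume p: "p \<in> S"
      show "\<bar>2 * pi * (real (multiplicity p n) * (t * ln (real p) - of_int (h p) - (- \<phi> * real (Q p) / (2 * pi))))\<bar>
          \<le> 2 * pi * (real (multiplicity p n) * \<epsilon>)"
        unfolding abs_mult using th[rule_format, OF p] by (intro mult_mono) auto
    qed
    also have "\<dots> = 2 * pi * \<Omega> n * \<epsilon>" by (simp add: \<Omega>_def sum_distrib_left sum_distrib_right mult_ac)
    finally show ?thesis .
  qed
  have "norm (\<Sum>n\<in>I. b n * w ^ additive_weight Q n)
      = norm ((\<Sum>n\<in>I. b n * cis (- s * ln (real n)))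
        + (\<Sum>n\<in>I. b n * (w ^ additive_weight Q n - cis (- s * ln (real n)))))"
    by (simp add: right_diff_distrib sum_subtractf)
  also have "\<dots> \<le> A + (\<Sum>n\<in>I. norm (b n) * (2 * pi * \<Omega> n * \<epsilon>))"
    using step
    by (intro norm_triangle_le add_mono bound sum_norm_le) (auto simp: norm_mult intro!: mult_left_mono)
  also have "(\<Sum>n\<in>I. norm (b n) * (2 * pi * \<Omega> n * \<epsilon>)) = B * \<epsilon>"
    by (simp add: B_def sum_distrib_left mult_ac)
  also have "B * \<epsilon> \<le> \<delta>" using B0 \<delta> by (simp add: \<epsilon>_def field_simps)
  finally show "norm (\<Sum>n\<in>I. b n * w ^ additive_weight Q n) \<le> A + \<delta>" by simp
qed

section \<open>Integer weights\<close>

text \<open>The inequalities are assumed only up to \<open>N^2\<close>. A larger \<open>n\<close>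
  whose prime factors are at most \<open>N\<close> has a divisor between \<open>N\<close> and
  \<open>N^2\<close>, and additivity passes the inequality on to \<open>n\<close>. A prime above
  \<open>N\<close> gets weight \<open>q + 1\<close>, which exceeds the threshold by itself.\<close>

lemma smooth_threshold_iff:
  fixes Q :: "nat \<Rightarrow> nat"
  assumes P0: "\<And>p. p \<in> P0 \<Longrightarrow> prime p" and N: "N > 0"
    and small: "\<And>n. 0 < n \<Longrightarrow> n \<le> N \<Longrightarrow> prime_factors n \<subseteq> P0 \<Longrightarrow> additive_weight Q n \<le> q"
    and large: "\<And>n. N < n \<Longrightarrow> n \<le> N\<^sup>2 \<Longrightarrow> prime_factors n \<subseteq> {p\<in>P0. p \<le> N} \<Longrightarrow> q < additive_weight Q n"
    and n: "n \<in> smooth_integers P0"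
  shows "additive_weight (\<lambda>p. if p \<le> N then Q p else q + 1) n \<le> q \<longleftrightarrow> n \<le> N"
proof -
  let ?Q = "\<lambda>p. if p \<le> N then Q p else q + 1"
  have n0: "n > 0" and pf: "prime_factors n \<subseteq> P0"
    using n by (auto simp: smooth_integers_def in_prime_factors_iff)
  have eq: "additive_weight ?Q n = additive_weight Q n" if "\<forall>p\<in>prime_factors n. p \<le> N"
    unfolding additive_weight_def by (rule sum.cong) (use that in auto)
  show ?thesis
  proof (cases "n \<le> N")
    case True
    then have "\<forall>p\<in>prime_factors n. p \<le> N"
      using n0 by (auto simp: in_prime_factors_iff dest!: dvd_imp_le)
    then show ?thesis using eq small[OF n0 True pf] True by simp
  next
    case False
    have "q < additive_weight ?Q n"
    proof (cases "\<forall>p\<in>prime_factors n. p \<le> N")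
      case True
      \<comment> \<open>Removing a prime factor \<open>p\<close> from the least divisor above
        \<open>N\<close> leaves at most \<open>N\<close>; since \<open>p\<close> is also at most
        \<open>N\<close>, this gives \<open>d \<le> N^2\<close>.\<close>
      define d where "d = (LEAST d. d dvd n \<and> N < d)"
      have d: "d dvd n \<and> N < d" unfolding d_def by (rule LeastI[of _ n]) (use False in auto)
      have d_least: "e \<le> N" if "e dvd n" "e < d" for e
        using not_less_Least[of e "\<lambda>d. d dvd n \<and> N < d"] that by (auto simp: d_def)
      have "d \<noteq> 1" using d N by auto
      then obtain p where p: "prime p" "p dvd d" using prime_factor_nat by blast
      then obtain e where e: "d = p * e" by blast
      have pN: "p \<le> N" using True p d n0 by (auto simp: in_prime_factors_iff intro: dvd_trans)
      have "e > 0" using d e N by (auto intro: Nat.gr0I)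
      then have "e < d" using prime_gt_1_nat[OF p(1)] by (simp add: e)
      moreover have "e dvd n" using d e by (metis dvd_mult_right)
      ultimately have "e \<le> N" using d_least by blast
      then have "d \<le> N\<^sup>2" unfolding e power2_eq_square using pN by (rule mult_le_mono[rotated])
      moreover have "prime_factors d \<subseteq> {p\<in>P0. p \<le> N}"
        using dvd_prime_factors[of n d] d n0 pf True by blast
      ultimately have "q < additive_weight Q d" using large d by blast
      moreover obtain m where m: "n = d * m" using d by blast
      then have "additive_weight Q n = additive_weight Q d + additive_weight Q m"
        using n0 by (simp add: additive_weight_mult)
      ultimately show ?thesis using eq[OF True] by simp
    next
      case False
      then obtain p where p: "p \<in> prime_factors n" "\<not> p \<le> N" by blast
      have "q < 1 * (q + 1)" by simp
      also have "\<dots> \<le> multiplicity p n * ?Q p"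
        using p by (intro mult_le_mono) (auto simp: prime_factors_multiplicity)
      also have "\<dots> \<le> additive_weight ?Q n"
        unfolding additive_weight_def of_nat_id using p(1) by (intro member_le_sum) auto
      finally show ?thesis .
    qed
    then show ?thesis using False by simp
  qed
qed

text \<open>\<open>ln N\<close> and \<open>ln (N + 1)\<close> differ by at least
  \<open>1 / (N + 1)\<close>, which scaling by \<open>L\<close> turns into at least
  \<open>4 * N\<close>. Rounding changes the weight of \<open>n \<le> N^2\<close> by at most
  \<open>2 * ln n\<close>, which is less than that.\<close>

lemma rounded_log_weights:
  assumes "N \<ge> 2"
  obtains Q :: "nat \<Rightarrow> nat" and q where
    "\<And>n. 0 < n \<Longrightarrow> n \<le> N \<Longrightarrow> additive_weight Q n \<le> q"
    "\<And>n. N < n \<Longrightarrow> n \<le> N\<^sup>2 \<Longrightarrow> q < additive_weight Q n"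
    "q + 1 \<le> N ^ 7"
proof -
  define L where "L = 4 * real N * (real N + 1)"
  define Q where "Q p = nat \<lfloor>L * ln (real p)\<rfloor>" for p :: nat
  define q where "q = nat \<lfloor>L * ln (real N)\<rfloor>"
  have L0: "L \<ge> 0" by (simp add: L_def)
  have lnN: "0 \<le> ln (real N)" "ln (real N) < real N"
    using assms ln_less_self[of "real N"] by auto
  \<comment> \<open>Rounding down loses at most \<open>1 \<le> 2 * ln p\<close>; written in this
    form, the losses add up to \<open>2 * ln n\<close>.\<close>
  have Q_bounds: "real (Q p) \<le> L * ln (real p)" "L * ln (real p) - 2 * ln (real p) \<le> real (Q p)"
    if "prime p" for p
  proof -
    have "ln 2 \<le> ln (real p)" using prime_ge_2_nat[OF that] by simp
    then have "1 \<le> 2 * ln (real p)" using ln2_ge_two_thirds by simp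
    moreover have "0 \<le> L * ln (real p)" using L0 \<open>1 \<le> _\<close> by simp
    ultimately show "real (Q p) \<le> L * ln (real p)" "L * ln (real p) - 2 * ln (real p) \<le> real (Q p)"
      unfolding Q_def by linarith+
  qed
  have real_w: "real (additive_weight Q n) = (\<Sum>p\<in>prime_factors n. real (multiplicity p n) * real (Q p))" for n
    by (simp add: additive_weight_def)
  have ln_w: "c * ln (real n) = (\<Sum>p\<in>prime_factors n. real (multiplicity p n) * (c * ln (real p)))"
    if "n > 0" for n and c :: real
    by (subst additive_weight_ln[OF that, symmetric]) (simp add: additive_weight_def sum_distrib_left mult_ac)
  show thesis
  proof
    fix n :: nat assume n: "0 < n" "n \<le> N"
    have "real (additive_weight Q n) \<le> L * ln (real n)"
      unfolding real_w ln_w[OF n(1)]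
      by (intro sum_mono mult_left_mono Q_bounds) (auto simp: in_prime_factors_iff)
    also have "\<dots> \<le> L * ln (real N)" using n L0 by (intro mult_left_mono) auto
    finally show "additive_weight Q n \<le> q" unfolding q_def by linarith
  next
    fix n :: nat assume n: "N < n" "n \<le> N\<^sup>2"
    have n0: "n > 0" using n by simp
    have "ln (real N / (real N + 1)) \<le> real N / (real N + 1) - 1"
      using assms by (intro ln_le_minus_one) auto
    also have "\<dots> = - 1 / (real N + 1)" by (simp add: field_simps)
    finally have gap: "ln (real N) + 1 / (real N + 1) \<le> ln (real N + 1)"
      using assms by (simp add: ln_div)
    have "ln (real n) \<le> ln (real (N\<^sup>2))" using n n0 assms by (subst ln_le_cancel_iff) auto
    then have ln_n: "ln (real n) \<le> 2 * ln (real N)" using assms by (simp add: ln_realpow)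
    have "L * (1 / (real N + 1)) = 4 * real N" by (simp add: L_def)
    then have "L * ln (real N) + 4 * real N = L * (ln (real N) + 1 / (real N + 1))"
      by (simp only: distrib_left)
    also have "\<dots> \<le> L * ln (real N + 1)" using gap L0 by (rule mult_left_mono)
    also have "\<dots> \<le> L * ln (real n)" using n L0 by (intro mult_left_mono) auto
    finally have "L * ln (real N) < L * ln (real n) - 2 * ln (real n)" using ln_n lnN by linarith
    also have "\<dots> = (L - 2) * ln (real n)" by (simp add: left_diff_distrib)
    also have "\<dots> \<le> real (additive_weight Q n)"
      unfolding real_w ln_w[OF n0] left_diff_distrib
      by (intro sum_mono mult_left_mono Q_bounds) (auto simp: in_prime_factors_iff)
    finally show "q < additive_weight Q n" using L0 lnN unfolding q_def by (simp add: floor_less_iff zero_le_mult_iff nat_less_iff)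
  next
    have "real q \<le> L * ln (real N)" using L0 lnN by (simp add: q_def)
    also have "\<dots> \<le> L * real N" using L0 lnN by (intro mult_left_mono) auto
    also have "\<dots> = real (4 * N * (N + 1) * N)" by (simp add: L_def algebra_simps)
    finally have "q \<le> 4 * N * (N + 1) * N" by linarith
    also have "\<dots> < 4 * N * (N + 1) * (N + 1)" using assms by simp
    also have "\<dots> \<le> (N * N) * N * (N * N) * (N * N)"
    proof -
      have "N + 1 \<le> N * N" "4 \<le> N * N"
        using assms mult_le_mono[OF assms assms] mult_le_mono1[OF assms, of N] by linarith+
      then show ?thesis by (intro mult_le_mono) auto
    qed
    also have "\<dots> = N ^ 7" by (simp add: eval_nat_numeral mult_ac)
    finally show "q + 1 \<le> N ^ 7" by simp
  qed
qed

text \<open>The logarithms solve the system of inequalities over the reals, and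
  \<open>short_integer_solution\<close> replaces them by small integers. \<open>M\<close> bounds the
  coefficients, and the exponent is one less than the number \<open>card P + 2\<close> of
  unknowns.\<close>

lemma small_integer_weights:
  assumes fin: "finite P" and P: "\<And>p. p \<in> P \<Longrightarrow> prime p" and N: "N > 0"
    and M: "M > 0" "\<And>p n. p \<in> P \<Longrightarrow> 0 < n \<Longrightarrow> n \<le> N\<^sup>2 \<Longrightarrow> multiplicity p n \<le> M"
  obtains Q :: "nat \<Rightarrow> nat" and q where
    "\<And>n. 0 < n \<Longrightarrow> n \<le> N \<Longrightarrow> prime_factors n \<subseteq> P \<Longrightarrow> additive_weight Q n \<le> q"
    "\<And>n. N < n \<Longrightarrow> n \<le> N\<^sup>2 \<Longrightarrow> prime_factors n \<subseteq> P \<Longrightarrow> q < additive_weight Q n"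
    "q \<le> (2 * (card P + 2) * M) ^ (card P + 1)"
proof -
  \<comment> \<open>As indices, \<open>0\<close> and \<open>1\<close> are not primes: they stand for the threshold and for the gap above it.\<close>
  define V where "V = insert 0 (insert 1 P)"
  have notP: "0 \<notin> P" "Suc 0 \<notin> P" using P by fastforce+
  have finV: "finite V" and cardV: "card V = card P + 2" using fin notP by (auto simp: V_def)
  have sumV: "(\<Sum>v\<in>V. g v) = g 0 + (g 1 + (\<Sum>p\<in>P. g p))" for g :: "nat \<Rightarrow> 'x::comm_monoid_add"
    using fin notP by (simp add: V_def)
  define E1 where "E1 = {n. 0 < n \<and> n \<le> N\<^sup>2 \<and> prime_factors n \<subseteq> P}"
  have finE1: "finite E1" by (rule finite_subset[of _ "{..N\<^sup>2}"]) (auto simp: E1_def)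
  \<comment> \<open>Nonnegativity of the form \<open>c1 n\<close> puts the weight of
    \<open>n\<close> at or below the threshold; that of \<open>c2 n\<close> puts it at least one gap
    above.\<close>
  define c1 where "c1 n v = (if v = 0 then 1 else if v = 1 then 0 else - int (multiplicity v n))" for n v :: nat
  define c2 where "c2 n v = (if v = 0 then - 1 else if v = 1 then - 1 else int (multiplicity v n))" for n v :: nat
  \<comment> \<open>\<open>Inl\<close> indexes the constraints that come from integers
    \<open>n\<close>, \<open>Inr\<close> the nonnegativity of each unknown.\<close>
  define e where "e = case_sum (\<lambda>n. if n \<le> N then c1 n else c2 n) (\<lambda>u v. if v = u then (1::int) else 0)"
  define E where "E = Inl ` E1 \<union> Inr ` V"
  define y where "y v = (if v = 0 then ln (real N) else if v = 1 then ln (real N + 1) - ln (real N) else ln (real v))" for v :: nat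
  have multP: "(\<Sum>p\<in>P. g p * y p) = (\<Sum>p\<in>P. g p * ln (real p))" for g :: "nat \<Rightarrow> real"
    by (rule sum.cong) (use notP in \<open>auto simp: y_def\<close>)
  have c1_sum: "(\<Sum>v\<in>V. of_int (c1 n v) * x v) = x 0 - (\<Sum>p\<in>P. of_nat (multiplicity p n) * x p)"
    for n and x :: "nat \<Rightarrow> 'x::comm_ring_1"
  proof -
    have "(\<Sum>p\<in>P. of_int (c1 n p) * x p) = (\<Sum>p\<in>P. - (of_nat (multiplicity p n) * x p))"
      by (rule sum.cong) (use notP in \<open>auto simp: c1_def\<close>)
    then show ?thesis by (simp add: sumV sum_negf c1_def[of _ 0] c1_def[of _ "Suc 0"])
  qed
  have c2_sum: "(\<Sum>v\<in>V. of_int (c2 n v) * x v) = (\<Sum>p\<in>P. of_nat (multiplicity p n) * x p) - x 0 - x 1"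
    for n and x :: "nat \<Rightarrow> 'x::comm_ring_1"
  proof -
    have "(\<Sum>p\<in>P. of_int (c2 n p) * x p) = (\<Sum>p\<in>P. of_nat (multiplicity p n) * x p)"
      by (rule sum.cong) (use notP in \<open>auto simp: c2_def\<close>)
    then show ?thesis by (simp add: sumV c2_def[of _ 0] c2_def[of _ "Suc 0"])
  qed
  have y_feas: "(\<Sum>v\<in>V. of_int (e i v) * y v) \<ge> 0" if "i \<in> E" for i
  proof (cases i)
    case (Inl n)
    then have n: "0 < n" "prime_factors n \<subseteq> P" using that by (auto simp: E_def E1_def)
    have ln_n: "(\<Sum>p\<in>P. real (multiplicity p n) * y p) = ln (real n)"
      unfolding multP using additive_weight_eq_sum[OF fin n(2) P, of "\<lambda>p. ln (real p)"] additive_weight_ln[OF n(1)] by simp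
    show ?thesis
    proof (cases "n \<le> N")
      case True
      then show ?thesis using n c1_sum[of n y] by (simp add: e_def Inl ln_n) (simp add: y_def)
    next
      case False
      then have "ln (real N + 1) \<le> ln (real n)" by (subst ln_le_cancel_iff) auto
      then show ?thesis using False c2_sum[of n y] by (simp add: e_def Inl ln_n) (simp add: y_def)
    qed
  next
    case (Inr u)
    then have u: "u \<in> V" using that by (auto simp: E_def)
    have "(\<Sum>v\<in>V. of_int (e i v) * y v) = (\<Sum>v\<in>V. if v = u then y v else 0)"
      by (rule sum.cong) (auto simp: e_def Inr)
    also have "\<dots> = y u" using u finV by simp
    also have "\<dots> \<ge> 0"
      using u N P by (auto simp: y_def V_def prime_ge_1_nat)
    finally show ?thesis .
  qed
  have e_bound: "\<bar>e i v\<bar> \<le> int M" if "i \<in> E" "v \<in> V" for i v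
  proof (cases i)
    case (Inl n)
    then have "v \<in> P \<Longrightarrow> multiplicity v n \<le> M" using that M(2) by (auto simp: E_def E1_def)
    then show ?thesis using that(2) M(1) by (auto simp: Inl e_def c1_def c2_def V_def)
  qed (use M(1) in \<open>simp add: e_def\<close>)
  \<comment> \<open>The distinguished coordinate is the gap: being at least \<open>1\<close>, it
    makes the inequality above \<open>N\<close> strict.\<close>
  obtain z where z: "z 1 \<ge> 1" "\<And>i. i \<in> E \<Longrightarrow> (\<Sum>v\<in>V. e i v * z v) \<ge> 0"
    "\<And>v. v \<in> V \<Longrightarrow> 0 \<le> z v" "\<And>v. v \<in> V \<Longrightarrow> z v \<le> int ((2 * card V * M) ^ (card V - 1))"
  proof (rule short_integer_solution[of V E 1 y e M])
    show "finite E" using finE1 finV by (simp add: E_def)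
    show "0 < y 1" using N by (simp add: y_def)
    show "\<exists>i\<in>E. \<forall>u\<in>V. e i u = (if u = v then 1 else 0)" if "v \<in> V" for v
      using that by (intro bexI[of _ "Inr v"]) (auto simp: E_def e_def)
    show "\<bar>e i v\<bar> \<le> int M" if "i \<in> E" "v \<in> V" for i v using that by (rule e_bound)
    show "0 \<le> (\<Sum>v\<in>V. real_of_int (e i v) * y v)" if "i \<in> E" for i using that by (rule y_feas)
  qed (use finV M(1) in \<open>simp_all add: V_def\<close>)
  define Q where "Q p = nat (z p)" for p
  have wQ: "int (additive_weight Q n) = (\<Sum>p\<in>P. int (multiplicity p n) * z p)"
    if "prime_factors n \<subseteq> P" for n
  proof -
    have "int (additive_weight Q n) = (\<Sum>p\<in>P. int (multiplicity p n) * int (Q p))"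
      using additive_weight_eq_sum[OF fin that P, of Q] by simp
    also have "\<dots> = (\<Sum>p\<in>P. int (multiplicity p n) * z p)"
      by (rule sum.cong) (use z(3) in \<open>auto simp: Q_def V_def\<close>)
    finally show ?thesis .
  qed
  show thesis
  proof
    fix n assume n: "0 < n" "n \<le> N" "prime_factors n \<subseteq> P"
    have "n \<le> N\<^sup>2" using n(2) by (metis le_trans power2_nat_le_imp_le power2_nat_le_eq_le le_square power2_eq_square)
    then have "(\<Sum>v\<in>V. c1 n v * z v) \<ge> 0"
      using z(2)[of "Inl n"] n by (simp add: E_def E1_def e_def)
    then have "int (additive_weight Q n) \<le> z 0"
      using c1_sum[of n z] wQ[OF n(3)] by simp
    then show "additive_weight Q n \<le> nat (z 0)" by linarith
  next
    fix n assume n: "N < n" "n \<le> N\<^sup>2" "prime_factors n \<subseteq> P"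
    then have "(\<Sum>v\<in>V. c2 n v * z v) \<ge> 0"
      using z(2)[of "Inl n"] by (simp add: E_def E1_def e_def)
    then have "z 0 < int (additive_weight Q n)"
      using c2_sum[of n z] wQ[OF n(3)] z(1) by simp
    then show "nat (z 0) < additive_weight Q n" using z(3)[of 0] by (simp add: V_def)
  next
    have "z 0 \<le> int ((2 * card V * M) ^ (card V - 1))" using z(4) by (simp add: V_def)
    then show "nat (z 0) \<le> (2 * (card P + 2) * M) ^ (card P + 1)"
      unfolding cardV by (simp add: nat_le_iff)
  qed
qed

section \<open>Gaussian smoothing\<close>

lemma open_right_half_plane: "open right_half_plane"
  unfolding right_half_plane_def by (rule open_halfspace_Re_gt)

lemma measurable_vertical_translate:
  fixes g :: "complex \<Rightarrow> complex" and M :: "real measure"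
  assumes "continuous_on right_half_plane g" "s \<in> right_half_plane" "sets M = sets borel"
  shows "(\<lambda>x. g (s + \<i> * of_real (\<delta> * x))) \<in> borel_measurable M"
proof -
  have "continuous_on UNIV (\<lambda>x. g (s + \<i> * of_real (\<delta> * x)))"
    by (rule continuous_on_compose2[OF assms(1)])
       (use assms(2) in \<open>auto simp: right_half_plane_def intro!: continuous_intros\<close>)
  then have "(\<lambda>x. g (s + \<i> * of_real (\<delta> * x))) \<in> borel_measurable borel"
    by (rule borel_measurable_continuous_onI)
  then show ?thesis by (simp add: measurable_cong_sets[OF assms(3) refl])
qed

lemma integrable_vertical_translate:
  fixes f :: "complex \<Rightarrow> complex" and M :: "real measure"
  assumes f: "continuous_on right_half_plane f"
    and bound: "\<And>s. s \<in> right_half_plane \<Longrightarrow> norm (f s) \<le> B"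
    and M: "prob_space M" "sets M = sets borel" and s: "s \<in> right_half_plane"
  shows "integrable M (\<lambda>x. f (s + \<i> * of_real (\<delta> * x)))"
proof -
  have "finite_measure M" using M(1) by (rule prob_space.axioms)
  then show ?thesis
    using measurable_vertical_translate[OF f s M(2)] bound s
    by (intro finite_measure.integrable_const_bound[where B = B]) (auto simp: right_half_plane_def)
qed

text \<open>Differentiation under the integral sign by dominated convergence. Vertical translation
  preserves the distance to the boundary, so Cauchy's inequality bounds the difference quotients of
  all translates by one constant.\<close>

lemma holomorphic_on_vertical_average:
  fixes f :: "complex \<Rightarrow> complex" and M :: "real measure"
  assumes f: "f holomorphic_on right_half_plane"
    and bound: "\<And>s. s \<in> right_half_plane \<Longrightarrow> norm (f s) \<le> B"
    and M: "prob_space M" "sets M = sets borel"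
  shows "(\<lambda>s. \<integral>x. f (s + \<i> * of_real (\<delta> * x)) \<partial>M) holomorphic_on right_half_plane"
proof -
  have finM: "finite_measure M" using M(1) by (rule prob_space.axioms)
  define h where "h x = \<i> * of_real (\<delta> * x)" for x
  have Re_h: "Re (h x) = 0" for x by (simp add: h_def)
  have in_plane: "s + h x \<in> right_half_plane" if "s \<in> right_half_plane" for s x
    using that by (simp add: right_half_plane_def Re_h)
  have f': "(f has_field_derivative deriv f s) (at s)" if "s \<in> right_half_plane" for s
    using f open_right_half_plane that by (rule holomorphic_derivI)
  have contf: "continuous_on right_half_plane f"
    using f by (rule holomorphic_on_imp_continuous_on)
  have contf': "continuous_on right_half_plane (deriv f)"
    using f open_right_half_plane by (intro holomorphic_on_imp_continuous_on holomorphic_deriv)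
  have meas: "(\<lambda>x. g (s + h x)) \<in> borel_measurable M"
    if "continuous_on right_half_plane g" "s \<in> right_half_plane" for g :: "complex \<Rightarrow> complex" and s
    using measurable_vertical_translate[OF that M(2)] by (simp add: h_def)
  have int: "integrable M (\<lambda>x. f (s + h x))" if "s \<in> right_half_plane" for s
    using integrable_vertical_translate[OF contf bound M that] by (simp add: h_def)
  define G where "G s = (\<integral>x. f (s + h x) \<partial>M)" for s
  have "(G has_field_derivative (\<integral>x. deriv f (s + h x) \<partial>M)) (at s)" if s: "s \<in> right_half_plane" for s
    unfolding has_field_derivative_iff tendsto_at_iff_sequentially
  proof (intro allI impI)
    fix X :: "nat \<Rightarrow> complex" assume X: "\<forall>i. X i \<in> UNIV - {s}" "X \<longlonglongrightarrow> s"
    \<comment> \<open>A third of the distance to the boundary: discs of radius \<open>r\<close>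
      about points within \<open>r\<close> of \<open>s + h x\<close> stay in the half-plane.\<close>
    define r where "r = Re s / 3"
    have r: "r > 0" using s by (simp add: r_def right_half_plane_def)
    have near: "w \<in> right_half_plane" if "dist (s + h x) w < 3 * r" for w x
    proof -
      have "\<bar>Re (s + h x - w)\<bar> < 3 * r"
        using abs_Re_le_cmod[of "s + h x - w"] that by (simp only: dist_norm)
      then show ?thesis by (simp add: right_half_plane_def Re_h r_def)
    qed
    have deriv_bound: "norm (deriv f w) \<le> B / r" if "w \<in> ball (s + h x) r" for w x
    proof -
      have sub: "cball w r \<subseteq> right_half_plane"
      proof
        fix u assume "u \<in> cball w r"
        then have "dist (s + h x) u < 3 * r"
          using that dist_triangle[of "s + h x" u w] r by simp
        then show "u \<in> right_half_plane" by (rule near)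
      qed
      have "norm ((deriv ^^ 1) f w) \<le> fact 1 * B / r ^ 1"
      proof (rule Cauchy_inequality)
        show "f holomorphic_on ball w r"
          using f sub by (meson ball_subset_cball holomorphic_on_subset)
        show "continuous_on (cball w r) f" using contf sub continuous_on_subset by blast
        show "norm (f u) \<le> B" if "norm (w - u) = r" for u
          using bound sub that by (auto simp: dist_norm)
      qed (rule r)
      then show ?thesis by simp
    qed
    obtain n0 where n0: "\<And>n. n \<ge> n0 \<Longrightarrow> dist (X n) s < r"
      using X(2) r by (meson metric_LIMSEQ_D)
    \<comment> \<open>Dropping finitely many terms puts the whole sequence within \<open>r\<close>
      of \<open>s\<close> without changing the limit.\<close>
    define Y where "Y n = X (n + n0)" for n
    have Y: "Y \<longlonglongrightarrow> s" "\<And>n. Y n \<noteq> s" "\<And>n. dist s (Y n) < r"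
      using X n0 by (auto simp: Y_def[abs_def] LIMSEQ_ignore_initial_segment dist_commute)
    have Yp: "Y n \<in> right_half_plane" for n
      using near[of 0 "Y n"] Y(3)[of n] r by (simp add: h_def)
    define D where "D n x = (f (Y n + h x) - f (s + h x)) / (Y n - s)" for n x
    have "(\<lambda>n. \<integral>x. D n x \<partial>M) \<longlonglongrightarrow> (\<integral>x. deriv f (s + h x) \<partial>M)"
    proof (rule integral_dominated_convergence[where w = "\<lambda>_. B / r"])
      show "(\<lambda>x. deriv f (s + h x)) \<in> borel_measurable M" using meas[OF contf' s] .
      show "D n \<in> borel_measurable M" for n
        unfolding D_def[abs_def]
        by (intro borel_measurable_divide borel_measurable_diff meas[OF contf s] meas[OF contf Yp]) auto
      show "AE x in M. (\<lambda>n. D n x) \<longlonglongrightarrow> deriv f (s + h x)"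
      proof (rule AE_I2)
        fix x
        have "((\<lambda>z. (f z - f (s + h x)) / (z - (s + h x))) \<longlongrightarrow> deriv f (s + h x)) (at (s + h x))"
          using f'[OF in_plane[OF s]] unfolding has_field_derivative_iff .
        moreover have "filterlim (\<lambda>n. Y n + h x) (at (s + h x)) sequentially"
          using Y by (intro filterlim_atI tendsto_intros) auto
        ultimately have "(\<lambda>n. (f (Y n + h x) - f (s + h x)) / (Y n + h x - (s + h x)))
            \<longlonglongrightarrow> deriv f (s + h x)"
          by (rule filterlim_compose)
        then show "(\<lambda>n. D n x) \<longlonglongrightarrow> deriv f (s + h x)" by (simp add: D_def)
      qed
      show "AE x in M. norm (D n x) \<le> B / r" for n
      proof (rule AE_I2)
        fix x
        have "norm (f (Y n + h x) - f (s + h x)) \<le> B / r * norm (Y n + h x - (s + h x))"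
        proof (rule field_differentiable_bound[where S = "ball (s + h x) r" and f' = "deriv f"])
          show "(f has_field_derivative deriv f z) (at z within ball (s + h x) r)"
            if "z \<in> ball (s + h x) r" for z
            by (rule has_field_derivative_at_within, rule f', rule near[of x]) (use that r in auto)
          show "Y n + h x \<in> ball (s + h x) r" using Y(3)[of n] by (simp add: dist_norm)
        qed (use deriv_bound r in auto)
        then show "norm (D n x) \<le> B / r"
          using Y(2)[of n] by (simp add: D_def norm_divide field_simps)
      qed
    qed (rule finite_measure.integrable_const[OF finM])
    moreover have "(\<integral>x. D n x \<partial>M) = (G (Y n) - G s) / (Y n - s)" for n
      unfolding D_def G_def using int[OF Yp] int[OF s] by simp
    ultimately have "(\<lambda>n. (G (X (n + n0)) - G s) / (X (n + n0) - s)) \<longlonglongrightarrow> (\<integral>x. deriv f (s + h x) \<partial>M)"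
      by (simp add: Y_def)
    then show "((\<lambda>z. (G z - G s) / (z - s)) \<circ> X) \<longlonglongrightarrow> (\<integral>x. deriv f (s + h x) \<partial>M)"
      unfolding o_def by (rule LIMSEQ_offset)
  qed
  then have "G holomorphic_on right_half_plane"
    using open_right_half_plane by (auto simp: holomorphic_on_open)
  then show ?thesis by (simp add: G_def[abs_def] h_def)
qed

section \<open>Coefficient growth and the smoothed series\<close>

definition dirichlet_term :: "(nat \<Rightarrow> complex) \<Rightarrow> complex \<Rightarrow> nat \<Rightarrow> complex" where
  "dirichlet_term a s n = a (Suc n) * of_nat (Suc n) powr (- s)"

lemma of_nat_Suc_powr: "(of_nat (Suc n) powr s :: complex) = exp (s * of_real (ln (real (Suc n))))"
  by (simp add: powr_def Ln_of_nat del: of_nat_Suc)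

lemma norm_of_nat_Suc_powr: "norm (of_nat (Suc n) powr s :: complex) = exp (Re s * ln (real (Suc n)))"
  by (simp add: of_nat_Suc_powr del: of_nat_Suc)

text \<open>The terms of a convergent series are bounded.\<close>

lemma dirichlet_coeff_growth:
  assumes "summable (dirichlet_term a (of_real \<tau>))"
  obtains K where "K \<ge> 0" "\<And>n. norm (a (Suc n)) \<le> K * exp (\<tau> * ln (real (Suc n)))"
proof -
  obtain K where K: "\<And>n. norm (dirichlet_term a (of_real \<tau>) n) \<le> K"
    using summable_imp_Bseq[OF assms] by (auto simp: Bseq_def)
  have "norm (a (Suc n)) \<le> K * exp (\<tau> * ln (real (Suc n)))" for n
    using K[of n] unfolding dirichlet_term_def norm_mult norm_of_nat_Suc_powr
    by (simp add: exp_minus field_simps del: of_nat_Suc)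
  moreover have "K \<ge> 0" using K[of 0] norm_ge_zero order_trans by blast
  ultimately show thesis using that by blast
qed

lemma exp_minus_two_ln: "exp (- 2 * ln (real (Suc n))) = 1 / (real (Suc n))\<^sup>2"
proof -
  have "exp (- 2 * ln (real (Suc n))) = inverse (exp (ln (real (Suc n))) ^ 2)"
    by (simp only: exp_minus mult_minus_left exp_double)
  then show ?thesis by (simp add: inverse_eq_divide del: of_nat_Suc)
qed

lemma summable_exp_minus_two_ln: "summable (\<lambda>n. K * exp (- 2 * ln (real (Suc n))))"
proof -
  have "summable (\<lambda>n. 1 / (real (Suc n))\<^sup>2)"
    using inverse_squares_sums by (simp add: sums_iff add.commute)
  then show ?thesis unfolding exp_minus_two_ln by (rule summable_mult)
qed

text \<open>The factor is the characteristic function of the standard normal distribution at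
  \<open>- \<delta> * ln n\<close>, which results from averaging
  \<open>n powr (- \<i> * \<delta> * x)\<close> over a normal \<open>x\<close>.\<close>

definition gauss_coeff :: "real \<Rightarrow> (nat \<Rightarrow> complex) \<Rightarrow> nat \<Rightarrow> complex" where
  "gauss_coeff \<delta> a n = a n * exp (- of_real ((\<delta> * ln (real n))\<^sup>2 / 2))"

text \<open>
  \<open>f\<close> is averaged over vertical translations with Gaussian weight. This does not increase its
  supremum and multiplies \<open>a n\<close> by a factor that decays faster than any power of \<open>n\<close>, so the
  new series converges absolutely in the whole half-plane, where by analytic
  continuation it still represents the average.
\<close>

lemma gauss_coeff_series:
  fixes f :: "complex \<Rightarrow> complex" and a :: "nat \<Rightarrow> complex"
  assumes f: "f holomorphic_on right_half_plane"
    and bound: "\<And>s. s \<in> right_half_plane \<Longrightarrow> norm (f s) \<le> B"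
    and series: "has_dirichlet_series f a" and \<delta>: "\<delta> > 0" and s: "s \<in> right_half_plane"
  shows "summable (\<lambda>n. norm (dirichlet_term (gauss_coeff \<delta> a) s n))"
    and "norm (\<Sum>n. dirichlet_term (gauss_coeff \<delta> a) s n) \<le> B"
proof -
  obtain \<sigma> where \<sigma>: "\<sigma> \<ge> 0" "\<And>s. Re s > \<sigma> \<Longrightarrow> dirichlet_term a s sums f s"
    using series by (auto simp: has_dirichlet_series_def dirichlet_term_def[abs_def])
  define \<tau> where "\<tau> = \<sigma> + 1"
  obtain K where K: "K \<ge> 0" "\<And>n. norm (a (Suc n)) \<le> K * exp (\<tau> * ln (real (Suc n)))"
    by (rule dirichlet_coeff_growth[OF sums_summable[OF \<sigma>(2)[of "of_real \<tau>"]]]) (simp_all add: \<tau>_def)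
  \<comment> \<open>The constant comes from completing the square in \<open>l = ln n\<close>; the
    summand \<open>2\<close> beside \<open>\<tau>\<close> pays for the summable majorant
    \<open>n powr (- 2)\<close>.\<close>
  define K' where "K' = K * exp ((\<tau> + 2)\<^sup>2 / (2 * \<delta>\<^sup>2))"
  have term_bound: "norm (dirichlet_term (gauss_coeff \<delta> a) s n) \<le> K' * exp (- 2 * ln (real (Suc n)))"
    if "s \<in> right_half_plane" for s n
  proof -
    define l where "l = ln (real (Suc n))"
    have l: "l \<ge> 0" by (simp add: l_def)
    have "norm (dirichlet_term (gauss_coeff \<delta> a) s n)
        = norm (a (Suc n)) * exp (- ((\<delta> * l)\<^sup>2 / 2)) * exp (- Re s * l)"
      by (simp only: dirichlet_term_def gauss_coeff_def norm_mult norm_of_nat_Suc_powr norm_exp_eq_Re l_def) simp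
    also have "\<dots> \<le> (K * exp (\<tau> * l)) * exp (- ((\<delta> * l)\<^sup>2 / 2)) * 1"
      using K that l by (intro mult_mono) (auto simp: l_def right_half_plane_def)
    also have "\<dots> = K * exp (\<tau> * l - (\<delta> * l)\<^sup>2 / 2)" by (simp only: mult.assoc mult_1_right exp_add[symmetric] diff_conv_add_uminus)
    also have "\<dots> \<le> K * exp ((\<tau> + 2)\<^sup>2 / (2 * \<delta>\<^sup>2) + - 2 * l)"
    proof -
      have "0 \<le> (\<delta> * l - (\<tau> + 2) / \<delta>)\<^sup>2 / 2" by simp
      also have "\<dots> = (\<tau> + 2)\<^sup>2 / (2 * \<delta>\<^sup>2) + - 2 * l - (\<tau> * l - (\<delta> * l)\<^sup>2 / 2)"
      proof -
        have "\<delta> * l * ((\<tau> + 2) / \<delta>) = \<tau> * l + 2 * l" using \<delta> by (simp add: field_simps)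
        moreover have "((\<tau> + 2) / \<delta>)\<^sup>2 / 2 = (\<tau> + 2)\<^sup>2 / (2 * \<delta>\<^sup>2)" by (simp add: power_divide)
        moreover have "(A - C)\<^sup>2 / 2 = A\<^sup>2 / 2 + C\<^sup>2 / 2 - A * C" for A C :: real
          by (simp add: power2_diff field_simps)
        ultimately show ?thesis by simp
      qed
      finally show ?thesis using K(1) by (intro mult_left_mono) auto
    qed
    also have "\<dots> = K' * exp (- 2 * l)" by (simp only: K'_def exp_add mult.assoc)
    finally show ?thesis by (simp only: l_def)
  qed
  show "summable (\<lambda>n. norm (dirichlet_term (gauss_coeff \<delta> a) s n))"
    using term_bound[OF s] by (intro summable_comparison_test'[OF summable_exp_minus_two_ln[of K']]) auto
  have deriv: "((\<lambda>s. dirichlet_term (gauss_coeff \<delta> a) s n) has_field_derivative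
      gauss_coeff \<delta> a (Suc n) * (exp (- s * of_real (ln (real (Suc n)))) * - of_real (ln (real (Suc n))))) (at s)" for s n
    unfolding dirichlet_term_def of_nat_Suc_powr
    by (auto intro!: derivative_eq_intros simp del: of_nat_Suc)
  have "\<forall>\<^sub>F n in sequentially. \<forall>s\<in>right_half_plane.
      norm (dirichlet_term (gauss_coeff \<delta> a) s n) \<le> K' * exp (- 2 * ln (real (Suc n)))"
    using term_bound by (intro always_eventually) blast
  \<comment> \<open>The uniform majorant makes the sum \<open>F\<close> of the smoothed series
    differentiable on the whole half-plane.\<close>
  then obtain F F' where F: "\<forall>s\<in>right_half_plane. dirichlet_term (gauss_coeff \<delta> a) s sums F s \<and>
      (\<lambda>n. gauss_coeff \<delta> a (Suc n) * (exp (- s * of_real (ln (real (Suc n)))) * - of_real (ln (real (Suc n))))) sums F' s \<and>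
      (F has_field_derivative F' s) (at s)"
    by (rule series_and_derivative_comparison[OF open_right_half_plane summable_exp_minus_two_ln deriv])
  have F_holo: "F holomorphic_on right_half_plane"
    using F open_right_half_plane by (auto simp: holomorphic_on_open)
  have sets_std: "sets std_normal_distribution = sets borel" by simp
  have prob_std: "prob_space std_normal_distribution"
    using real_dist_normal_dist by (rule real_distribution.axioms)
  have fin_std: "finite_measure std_normal_distribution"
    using prob_std by (rule prob_space.axioms)
  define G where "G s = (\<integral>x. f (s + \<i> * of_real (\<delta> * x)) \<partial>std_normal_distribution)" for s
  have G_holo: "G holomorphic_on right_half_plane"
    unfolding G_def[abs_def] using f bound prob_std sets_std
    by (rule holomorphic_on_vertical_average)
  \<comment> \<open>So far to the right the original series has the majorant
    \<open>K * n powr (- 2)\<close> along the entire vertical line and may be integrated term by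
    term.\<close>
  have GF: "G s = F s" if s: "s \<in> {s. Re s > \<tau> + 2}" for s
  proof -
    have sp: "s \<in> right_half_plane" using s \<sigma>(1) by (simp add: \<tau>_def right_half_plane_def)
    define u where "u n x = dirichlet_term a (s + \<i> * of_real (\<delta> * x)) n" for n x
    have u_bound: "norm (u n x) \<le> K * exp (- 2 * ln (real (Suc n)))" for n x
    proof -
      define l where "l = ln (real (Suc n))"
      have l: "l \<ge> 0" by (simp add: l_def)
      have "norm (u n x) = norm (a (Suc n)) * exp (- Re s * l)"
        by (simp only: u_def dirichlet_term_def norm_mult norm_of_nat_Suc_powr l_def) simp
      also have "\<dots> \<le> K * exp (\<tau> * l) * exp (- Re s * l)"
        using K(2)[of n] by (intro mult_right_mono) (auto simp: l_def)
      also have "\<dots> = K * exp ((\<tau> - Re s) * l)" by (simp add: exp_add[symmetric] algebra_simps)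
      also have "\<dots> \<le> K * exp (- 2 * l)"
        using s l K(1) by (intro mult_left_mono iffD2[OF exp_le_cancel_iff] mult_right_mono) auto
      finally show ?thesis by (simp only: l_def)
    qed
    have u_cont: "continuous_on UNIV (u n)" for n
      unfolding u_def dirichlet_term_def of_nat_Suc_powr by (intro continuous_intros)
    have u_meas: "u n \<in> borel_measurable std_normal_distribution" for n
      using borel_measurable_continuous_onI[OF u_cont] by simp
    have u_int: "integrable std_normal_distribution (u n)" for n
      by (rule finite_measure.integrable_const_bound[OF fin_std _ u_meas]) (use u_bound in auto)
    have "(\<lambda>n. \<integral>x. u n x \<partial>std_normal_distribution) sums (\<integral>x. (\<Sum>n. u n x) \<partial>std_normal_distribution)"
    proof (rule sums_integral[OF u_int])
      show "AE x in std_normal_distribution. summable (\<lambda>n. norm (u n x))"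
        using u_bound by (intro AE_I2 summable_comparison_test'[OF summable_exp_minus_two_ln[of K]]) auto
      have "(\<integral>x. norm (u n x) \<partial>std_normal_distribution) \<le> K * exp (- 2 * ln (real (Suc n)))" for n
      proof -
        have "(\<integral>x. norm (u n x) \<partial>std_normal_distribution)
            \<le> (\<integral>x. K * exp (- 2 * ln (real (Suc n))) \<partial>std_normal_distribution)"
          by (intro integral_mono integrable_norm u_int u_bound finite_measure.integrable_const fin_std)
        then show ?thesis using prob_space.prob_space[OF prob_std] by simp
      qed
      then show "summable (\<lambda>n. \<integral>x. norm (u n x) \<partial>std_normal_distribution)"
        by (intro summable_comparison_test'[OF summable_exp_minus_two_ln[of K]]) auto
    qed
    moreover have "(\<Sum>n. u n x) = f (s + \<i> * of_real (\<delta> * x))" for x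
      using \<sigma>(2)[of "s + \<i> * of_real (\<delta> * x)"] s \<sigma>(1)
      by (auto simp: u_def \<tau>_def dest: sums_unique)
    moreover have "(\<integral>x. u n x \<partial>std_normal_distribution) = dirichlet_term (gauss_coeff \<delta> a) s n" for n
    proof -
      define l where "l = ln (real (Suc n))"
      have "u n x = a (Suc n) * exp (- s * of_real l) * exp (\<i> * of_real ((- \<delta> * l) * x))" for x
        unfolding u_def dirichlet_term_def of_nat_Suc_powr l_def[symmetric]
        by (simp add: algebra_simps flip: exp_add)
      then have "(\<integral>x. u n x \<partial>std_normal_distribution)
          = a (Suc n) * exp (- s * of_real l) * char std_normal_distribution (- \<delta> * l)"
        by (simp add: char_def)
      also have "\<dots> = dirichlet_term (gauss_coeff \<delta> a) s n"
        unfolding char_std_normal_distribution dirichlet_term_def of_nat_Suc_powr gauss_coeff_def l_def[symmetric]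
        by (simp flip: exp_of_real)
      finally show ?thesis .
    qed
    ultimately have "dirichlet_term (gauss_coeff \<delta> a) s sums G s"
      by (simp add: G_def)
    then show ?thesis using F sp sums_unique2 by blast
  qed
  have "F s = G s"
  proof (rule analytic_continuation_open[of "{s. Re s > \<tau> + 2}" right_half_plane F G])
    show "open {s. Re s > \<tau> + 2}" by (rule open_halfspace_Re_gt)
    show "{s. Re s > \<tau> + 2} \<noteq> {}" by (auto intro!: exI[of _ "of_real (\<tau> + 3)"])
    show "connected right_half_plane"
      unfolding right_half_plane_def by (intro convex_connected convex_halfspace_Re_gt)
    show "{s. Re s > \<tau> + 2} \<subseteq> right_half_plane"
      using \<sigma>(1) by (auto simp: \<tau>_def right_half_plane_def)
  qed (use open_right_half_plane F_holo G_holo GF s in auto)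
  moreover have "norm (G s) \<le> B"
  proof -
    have int: "integrable std_normal_distribution (\<lambda>x. f (s + \<i> * of_real (\<delta> * x)))"
      using holomorphic_on_imp_continuous_on[OF f] bound prob_std sets_std s
      by (rule integrable_vertical_translate)
    have "norm (G s) \<le> (\<integral>x. norm (f (s + \<i> * of_real (\<delta> * x))) \<partial>std_normal_distribution)"
      unfolding G_def by (rule integral_norm_bound)
    also have "\<dots> \<le> B"
      using s by (intro prob_space.integral_le_const[OF prob_std] integrable_norm int AE_I2 bound) (simp add: right_half_plane_def)
    finally show ?thesis .
  qed
  moreover have "(\<Sum>n. dirichlet_term (gauss_coeff \<delta> a) s n) = F s"
    using F s sums_unique by metis
  ultimately show "norm (\<Sum>n. dirichlet_term (gauss_coeff \<delta> a) s n) \<le> B" by simp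
qed

section \<open>The bound for partial sums\<close>

text \<open>Short integer solutions give \<open>ln q\<close> of order
  \<open>k * ln (k * ln N)\<close>, which suffices for \<open>k \<le> ln N\<close>. For larger
  \<open>k\<close> the rounded logarithms suffice, with \<open>ln q\<close> of order
  \<open>ln N < k\<close>.\<close>

lemma threshold_weights:
  assumes P0: "\<And>p. p \<in> P0 \<Longrightarrow> prime p" and N: "N > 0"
    and k: "prime_count P0 (real N) = k" "k \<ge> 1" and ll: "ln (ln (real N)) \<ge> 2"
  obtains Q :: "nat \<Rightarrow> nat" and q where
    "\<And>n. n \<in> smooth_integers P0 \<Longrightarrow> additive_weight Q n \<le> q \<longleftrightarrow> n \<le> N"
    "ln (real q + 1) \<le> 9 * real k * ln (ln (real N))"
proof -
  define l where "l = ln (real N)"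
  \<comment> \<open>Since \<open>ln 0 = 0\<close>, the hypothesis excludes
    \<open>l = 0\<close>.\<close>
  have "l \<noteq> 0" using ll by (auto simp: l_def)
  moreover have "l \<ge> 0" using N by (simp add: l_def)
  ultimately have l0: "l > 0" by simp
  have "l = exp (ln l)" using l0 by simp
  also have "\<dots> \<ge> exp 2" using ll by (simp add: l_def)
  finally have l5: "l \<ge> 5" using exp_lower_Taylor_quadratic[of 2] by simp
  have N2: "N \<ge> 2" using l5 N by (cases "N = 1") (auto simp: l_def)
  have ll1: "1 \<le> real k * ln l" using k(2) ll mult_mono[of 1 "real k" 1 "ln l"] by (simp add: l_def)
  define P where "P = {p\<in>P0. p \<le> N}"
  have finP: "finite P" and cardP: "card P = k"
    using k(1) by (auto simp: P_def prime_count_def)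
  have PP: "p \<in> P \<Longrightarrow> prime p" for p using P0 by (auto simp: P_def)
  have pfP: "prime_factors n \<subseteq> P" if "0 < n" "n \<le> N" "prime_factors n \<subseteq> P0" for n
    using that by (auto simp: P_def in_prime_factors_iff dest!: dvd_imp_le)
  show thesis
  proof (cases "real k \<le> l")
    case False
    obtain Q :: "nat \<Rightarrow> nat" and q where Q: "\<And>n. 0 < n \<Longrightarrow> n \<le> N \<Longrightarrow> additive_weight Q n \<le> q"
      "\<And>n. N < n \<Longrightarrow> n \<le> N\<^sup>2 \<Longrightarrow> q < additive_weight Q n" "q + 1 \<le> N ^ 7"
      using rounded_log_weights[OF N2] by metis
    show thesis
    proof (rule that)
      show "additive_weight (\<lambda>p. if p \<le> N then Q p else q + 1) n \<le> q \<longleftrightarrow> n \<le> N"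
        if "n \<in> smooth_integers P0" for n
        by (rule smooth_threshold_iff[OF P0 N]) (use Q(1,2) that in blast)+
      have "real q + 1 \<le> real N ^ 7" using Q(3) by (metis of_nat_1 of_nat_add of_nat_le_iff of_nat_power)
      then have "ln (real q + 1) \<le> ln (real N ^ 7)" using N by (subst ln_le_cancel_iff) auto
      also have "\<dots> = 7 * l" using N by (simp add: ln_realpow l_def)
      also have "\<dots> \<le> 7 * real k" using False by simp
      also have "\<dots> \<le> 9 * (real k * ln l)"
        using mult_left_mono[of 1 "ln l" "real k"] ll ll1 by (simp add: l_def)
      finally show "ln (real q + 1) \<le> 9 * real k * ln (ln (real N))" by (simp add: l_def)
    qed
  next
    case True
    \<comment> \<open>If \<open>p ^ v \<le> N^2\<close>, then \<open>v * ln 2 \<le> 2 * l\<close>,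
      and \<open>ln 2 \<ge> 2 / 3\<close> gives \<open>v \<le> 3 * l\<close>.\<close>
    define M where "M = nat \<lfloor>3 * l\<rfloor>"
    have M: "M > 0" "real M \<le> 3 * l" using l5 unfolding M_def by linarith+
    have mult_le: "multiplicity p n \<le> M" if "p \<in> P" "0 < n" "n \<le> N\<^sup>2" for p n
    proof -
      have p: "prime p" using PP that by blast
      have "p ^ multiplicity p n \<le> N\<^sup>2"
        using multiplicity_dvd[of p n] that dvd_imp_le le_trans by blast
      then have "real (p ^ multiplicity p n) \<le> real (N\<^sup>2)" by (simp only: of_nat_le_iff)
      then have "ln (real p ^ multiplicity p n) \<le> ln (real N ^ 2)"
        using prime_gt_0_nat[OF p] N by (subst ln_le_cancel_iff) auto
      then have "real (multiplicity p n) * ln (real p) \<le> 2 * l"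
        using prime_gt_0_nat[OF p] N by (simp add: ln_realpow l_def)
      moreover have "ln 2 \<le> ln (real p)" using prime_ge_2_nat[OF p] by simp
      then have "real (multiplicity p n) * (2 / 3) \<le> real (multiplicity p n) * ln (real p)"
        using ln2_ge_two_thirds by (intro mult_left_mono) auto
      ultimately have "real (multiplicity p n) \<le> 3 * l" by linarith
      then show ?thesis unfolding M_def by linarith
    qed
    obtain Q :: "nat \<Rightarrow> nat" and q where
      Q: "\<And>n. 0 < n \<Longrightarrow> n \<le> N \<Longrightarrow> prime_factors n \<subseteq> P \<Longrightarrow> additive_weight Q n \<le> q"
        "\<And>n. N < n \<Longrightarrow> n \<le> N\<^sup>2 \<Longrightarrow> prime_factors n \<subseteq> P \<Longrightarrow> q < additive_weight Q n"
        "q \<le> (2 * (card P + 2) * M) ^ (card P + 1)"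
      using small_integer_weights[OF finP PP N M(1) mult_le] by blast
    show thesis
    proof (rule that)
      show "additive_weight (\<lambda>p. if p \<le> N then Q p else q + 1) n \<le> q \<longleftrightarrow> n \<le> N"
        if "n \<in> smooth_integers P0" for n
        by (rule smooth_threshold_iff[OF P0 N]) (use Q pfP that in \<open>auto simp: P_def\<close>)
      define x where "x = real (2 * (k + 2) * M)"
      have "x = (2 * real k + 4) * real M" by (simp add: x_def algebra_simps)
      \<comment> \<open>\<open>2 * k + 4 \<le> 6 * l\<close> because \<open>k \<le> l\<close> and
        \<open>l \<ge> 1\<close>; the resulting factor \<open>18\<close> is below
        \<open>25 \<le> l^2\<close>.\<close>
      also have "\<dots> \<le> (6 * l) * (3 * l)"
        using True M k(2) by (intro mult_mono) auto
      also have "\<dots> = 18 * l\<^sup>2" by (simp add: power2_eq_square)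
      also have "\<dots> \<le> l\<^sup>2 * l\<^sup>2"
        using power_mono[OF l5, of 2] by (intro mult_right_mono) auto
      finally have x_le: "x \<le> l ^ 4" by (simp flip: power_add)
      have "1 \<le> 2 * (k + 2) * M" using M(1) by simp
      from of_nat_mono[OF this, where 'a = real] have x1: "x \<ge> 1" by (simp only: x_def of_nat_1)
      have "real q \<le> real ((2 * (k + 2) * M) ^ (k + 1))"
        using Q(3) unfolding cardP by (simp only: of_nat_le_iff)
      then have "real q + 1 \<le> x ^ (k + 1) + 1"
        by (simp only: x_def of_nat_power add_le_cancel_right)
      also have "\<dots> \<le> 2 * x ^ (k + 1)" using one_le_power[OF x1, of "k + 1"] by simp
      finally have "ln (real q + 1) \<le> ln (2 * x ^ (k + 1))" using x1 by (subst ln_le_cancel_iff) auto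
      also have "\<dots> = ln 2 + real (k + 1) * ln x" using x1 by (simp add: ln_mult ln_realpow algebra_simps)
      \<comment> \<open>Here \<open>k + 1 \<le> 2 * k\<close>; the summand \<open>1\<close> is
        absorbed afterwards by \<open>k * ln l \<ge> 1\<close>, which makes the constant
        \<open>9\<close>.\<close>
      also have "\<dots> \<le> 1 + (2 * real k) * (4 * ln l)"
      proof (intro add_mono mult_mono)
        show "ln 2 \<le> (1::real)" using ln_le_minus_one[of 2] by simp
        have "ln x \<le> ln (l ^ 4)" using x_le x1 by (subst ln_le_cancel_iff) auto
        then show "ln x \<le> 4 * ln l" using l0 by (simp add: ln_realpow)
      qed (use k(2) x1 in auto)
      also have "\<dots> \<le> 9 * (real k * ln l)" using ll1 by simp
      finally show "ln (real q + 1) \<le> 9 * real k * ln (ln (real N))" by (simp add: l_def)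
    qed
  qed
qed

theorem theorem5p2:
  shows "\<exists>C::real. \<forall>(P0::nat set) (N::nat).
           (\<forall>p\<in>P0. prime p) \<longrightarrow> N > 0 \<longrightarrow>
           prime_count P0 (real N) \<ge> 1 \<longrightarrow> ln (ln (real N)) \<ge> 2 \<longrightarrow>
           operator_norm_on (H_infinity_on P0) (partial_sum_op N)
             \<le> ereal (C * real (prime_count P0 (real N)) * ln (ln (real N)))"
proof (intro exI[of _ 20] allI impI)
  fix P0 :: "nat set" and N :: nat
  assume P0: "\<forall>p\<in>P0. prime p" and N: "N > 0"
    and k: "prime_count P0 (real N) \<ge> 1" and ll: "ln (ln (real N)) \<ge> 2"
  define X where "X = real (prime_count P0 (real N)) * ln (ln (real N))"
  have X: "X \<ge> 1" using k ll mult_mono[of 1 "real (prime_count P0 (real N))" 1 "ln (ln (real N))"]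
    by (simp add: X_def)
  obtain Q :: "nat \<Rightarrow> nat" and q where
    Q: "\<And>n. n \<in> smooth_integers P0 \<Longrightarrow> additive_weight Q n \<le> q \<longleftrightarrow> n \<le> N"
    and q: "ln (real q + 1) \<le> 9 * real (prime_count P0 (real N)) * ln (ln (real N))"
    using threshold_weights[OF _ N refl k ll] P0 by blast
  have partial_sum_le: "norm (\<Sum>n=1..N. a n * of_nat n powr (- s)) \<le> 2 * (1 + ln (real q + 1))"
    if f: "f holomorphic_on right_half_plane"
      and bound: "\<And>s. s \<in> right_half_plane \<Longrightarrow> norm (f s) \<le> 1"
      and series: "has_dirichlet_series f a"
      and thr: "\<And>n. n > 0 \<Longrightarrow> a n \<noteq> 0 \<Longrightarrow> additive_weight Q n \<le> q \<longleftrightarrow> n \<le> N"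
      and s: "s \<in> right_half_plane"
    for f :: "complex \<Rightarrow> complex" and a :: "nat \<Rightarrow> complex" and s
  proof -
    \<comment> \<open>The bound for the smoothed coefficients is uniform in \<open>\<delta>\<close>,
      so it survives the limit \<open>\<delta> \<rightarrow> 0\<close> in a finite sum.\<close>
    have smoothed: "norm (\<Sum>n=1..N. gauss_coeff \<delta> a n * of_nat n powr (- s)) \<le> 2 * (1 + ln (real q + 1))"
      if \<delta>: "\<delta> > 0" for \<delta>
    proof -
      define b where "b n = gauss_coeff \<delta> a n * of_nat n powr (- s)" for n
      define T where "T t n = b (Suc n) * cis (- t * ln (real (Suc n)))" for t n
      have T_eq: "dirichlet_term (gauss_coeff \<delta> a) (s + \<i> * of_real t) = T t" for t
        unfolding dirichlet_term_def T_def b_def of_nat_Suc_powr cis_conv_exp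
        by (simp add: fun_eq_iff algebra_simps flip: exp_add)
      have "s + \<i> * of_real t \<in> right_half_plane" for t
        using s by (simp add: right_half_plane_def)
      note T = gauss_coeff_series[OF f bound series \<delta> this, unfolded T_eq]
      have norm_T: "norm (T t n) = norm (b (Suc n))" for t n by (simp add: T_def norm_mult)
      have summ: "summable (\<lambda>n. norm (b (Suc n)))" using T(1) by (simp add: norm_T)
      \<comment> \<open>The norm of \<open>T t n\<close> does not depend on \<open>t\<close>, so one
        truncation point serves the whole vertical line. The tail, at most \<open>1\<close>, added
        to the supremum bound \<open>1\<close> gives the factor \<open>2\<close>.\<close>
      obtain M0 where M0: "\<And>n. n \<ge> M0 \<Longrightarrow> norm (\<Sum>i. norm (b (Suc (i + n)))) < 1"
        using suminf_exist_split[OF zero_less_one summ] by blast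
      define M where "M = max M0 N"
      have tail: "(\<Sum>i. norm (b (Suc (i + M)))) \<le> 1" using M0[of M] by (simp add: M_def)
      \<comment> \<open>Only nonzero coefficients are kept, because the threshold equivalence is
        known for these alone.\<close>
      define I where "I = {n\<in>{1..M}. a n \<noteq> 0}"
      have b0: "b n = 0" if "a n = 0" for n using that by (simp add: b_def gauss_coeff_def)
      have "norm (\<Sum>n\<in>I. b n * cis (- t * ln (real n))) \<le> 2" for t
      proof -
        have "(\<Sum>n\<in>I. b n * cis (- t * ln (real n))) = (\<Sum>n\<in>{1..M}. b n * cis (- t * ln (real n)))"
          by (rule sum.mono_neutral_left) (auto simp: I_def b0)
        also have "\<dots> = (\<Sum>n<M. T t n)"
          unfolding T_def by (rule sum.reindex_bij_witness[of _ Suc "\<lambda>n. n - 1"]) auto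
        also have "\<dots> = (\<Sum>n. T t n) - (\<Sum>n. T t (n + M))"
          using suminf_minus_initial_segment[OF summable_norm_cancel[OF T(1)], of t M] by simp
        also have "norm \<dots> \<le> 1 + 1"
        proof (intro norm_triangle_le_diff add_mono T(2))
          have "summable (\<lambda>n. norm (T t (n + M)))" using T(1) by (rule summable_ignore_initial_segment)
          then have "norm (\<Sum>n. T t (n + M)) \<le> (\<Sum>n. norm (T t (n + M)))" by (rule summable_norm)
          then show "norm (\<Sum>n. T t (n + M)) \<le> 1" using tail by (simp add: norm_T)
        qed
        finally show ?thesis by simp
      qed
      moreover have finI: "finite I" by (simp add: I_def)
      moreover have "n > 0" if "n \<in> I" for n using that by (simp add: I_def)
      ultimately have "norm (\<Sum>n\<in>I. b n * w ^ additive_weight Q n) \<le> 2" if "norm w = 1" for w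
        using that by (intro dirichlet_polynomial_bohr)
      with finI have "norm (\<Sum>n\<in>{n\<in>I. additive_weight Q n \<le> q}. b n) \<le> 2 * (1 + ln (real q + 1))"
        by (rule landau_partial_sum_le)
      also have "{n\<in>I. additive_weight Q n \<le> q} = {n\<in>{1..N}. a n \<noteq> 0}"
        using thr by (auto simp: I_def M_def)
      also have "(\<Sum>n\<in>{n\<in>{1..N}. a n \<noteq> 0}. b n) = (\<Sum>n=1..N. b n)"
        by (rule sum.mono_neutral_left) (auto simp: b0)
      finally show ?thesis by (simp only: b_def)
    qed
    have "(\<lambda>k. gauss_coeff (1 / real (Suc k)) a n) \<longlonglongrightarrow> a n * exp (- of_real ((0 * ln (real n))\<^sup>2 / 2))" for n
      unfolding gauss_coeff_def by (intro tendsto_intros LIMSEQ_Suc[OF lim_1_over_n]) simp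
    then have "(\<lambda>k. \<Sum>n=1..N. gauss_coeff (1 / real (Suc k)) a n * of_nat n powr (- s))
        \<longlonglongrightarrow> (\<Sum>n=1..N. a n * of_nat n powr (- s))"
      by (intro tendsto_sum tendsto_mult_right) simp
    then have "(\<lambda>k. norm (\<Sum>n=1..N. gauss_coeff (1 / real (Suc k)) a n * of_nat n powr (- s)))
        \<longlonglongrightarrow> norm (\<Sum>n=1..N. a n * of_nat n powr (- s))"
      by (rule tendsto_norm)
    then show ?thesis
      by (rule LIMSEQ_le_const2) (use smoothed in auto)
  qed
  have "norm (partial_sum_op N f s) \<le> 20 * X"
    if f: "f \<in> H_infinity_on P0" "sup_norm f \<le> 1" and s: "s \<in> right_half_plane" for f s
  proof -
    have "norm (partial_sum_op N f s) \<le> 2 * (1 + ln (real q + 1))"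
      unfolding partial_sum_op_def
    proof (rule partial_sum_le[OF _ _ _ _ s])
      show "f holomorphic_on right_half_plane"
        using f(1) by (auto simp: H_infinity_on_def H_infinity_def intro: analytic_imp_holomorphic)
      show "has_dirichlet_series f (dirichlet_coeff f)"
        unfolding dirichlet_coeff_def
        by (rule someI_ex[of "has_dirichlet_series f"]) (use f(1) in \<open>auto simp: H_infinity_on_def H_infinity_def\<close>)
      show "norm (f z) \<le> 1" if "z \<in> right_half_plane" for z
      proof -
        have "ereal (norm (f z)) \<le> sup_norm f"
          unfolding sup_norm_def using that by (rule SUP_upper)
        also have "\<dots> \<le> 1" by (fact f(2))
        finally show ?thesis by (simp add: one_ereal_def)
      qed
      show "additive_weight Q n \<le> q \<longleftrightarrow> n \<le> N" if "n > 0" "dirichlet_coeff f n \<noteq> 0" for n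
        using f(1) that by (intro Q) (auto simp: H_infinity_on_def Suc_le_eq)
    qed
    \<comment> \<open>\<open>2 * (1 + 9 * X) \<le> 20 * X\<close> because
      \<open>X \<ge> 1\<close>.\<close>
    also have "\<dots> \<le> 20 * X" using q X by (simp add: X_def)
    finally show ?thesis .
  qed
  then show "operator_norm_on (H_infinity_on P0) (partial_sum_op N)
      \<le> ereal (20 * real (prime_count P0 (real N)) * ln (ln (real N)))"
    by (auto simp: operator_norm_on_def sup_norm_def X_def mult.assoc intro!: SUP_least)
qed

end
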